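(* Let $q$ be a prime power, let $1\le k\le n\le m$ be integers, let $w$ be an integer with $w>\frac{n-k}{2}$, put $\xi:=w-\frac{n-k}{2}$, and let $Gab_k(\boldsymbol g)\subseteq\mathbb{F}_{q^m}^n$ be a Gabidulin code of length $n$ and dimension $k$. Let $\boldsymbol r$ be a uniformly distributed random element of $\mathbb{F}_{q^m}^n$. Then the column-erasure-aided randomized decoder (described in the context) requires on average at least $\mathcal{W}_{RD}$ operations over $\mathbb{F}_{q^m}$ to output a codeword $\boldsymbol c\in Gab_k(\boldsymbol g)$ with $\mathrm{rk}(\boldsymbol r-\boldsymbol c)\le w$, where $\mathcal{W}_{RD}$ (defined in the context) satisfies $$\mathcal{W}_{RD}\ge\frac{n}{64}\cdot q^{\,m(n-k)-w(n+m)+w^2+\min\{2\xi(\frac{n+k}{2}-\xi),\,wk\}}.$$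
   Context: Notation. $\mathbb{F}_{q^m}$ is the degree-$m$ extension of $\mathbb{F}_q$. For $\boldsymbol a\in\mathbb{F}_{q^m}^n$, $\mathrm{rk}(\boldsymbol a)$ is the dimension of the $\mathbb{F}_q$-span of its entries. $\begin{bmatrix} a\\ b\end{bmatrix}_q$ is the Gaussian binomial coefficient (the number of $b$-dimensional subspaces of $\mathbb{F}_q^a$; zero if $b<0$ or $b>a$). Intervals $[2\xi,n-k]$ for $\delta$ consist of integers (note that $2\xi$ is an integer). Definition of $\mathcal{W}_{RD}$: $$\mathcal{W}_{RD}=\min_{\delta\in[2\xi,n-k]}\left\{\frac{n^2}{\sum_{j=0}^{w}\bar A_j\,P_{n,k,\delta,j}}\right\},\qquad \bar A_j=q^{m(k-n)}\prod_{i=0}^{j-1}\frac{(q^m-q^{i})(q^n-q^{i})}{q^j-q^{i}},$$ where $P_{n,k,\delta,j}:=\begin{bmatrix} n\\ \delta\end{bmatrix}_q^{-1}\sum_{i=\lceil j-\frac{n-k}{2}+\frac{\delta}{2}\rceil}^{\min\{\delta,j\}}\begin{bmatrix} n-j\\ \delta-i\end{bmatrix}_q\begin{bmatrix} j\\ i\end{bmatrix}_q q^{(j-i)(\delta-i)}$ if $2j+\delta>n-k$, and $P_{n,k,\delta,j}:=1$ otherwise. Gabidulin code. For $\boldsymbol g=(g_1,\dots,g_n)\in\mathbb{F}_{q^m}^n$ with entries linearly independent over $\mathbb{F}_q$, $Gab_k(\boldsymbol g)$ is the $\mathbb{F}_{q^m}$-linear code generated by the $k\times n$ matrix with $(i,j)$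 entry $g_j^{q^{i-1}}$. Error-erasure decoder. Given $\boldsymbol r\in\mathbb{F}_{q^m}^n$ and a full-rank matrix $\boldsymbol B_C\in\mathbb{F}_q^{\delta\times n}$ (with row space $\mathcal U$), the decoder returns the codeword $\boldsymbol c\in Gab_k(\boldsymbol g)$ for which there is $\boldsymbol a_C\in\mathbb{F}_{q^m}^{\delta}$ with $t:=\mathrm{rk}(\boldsymbol r-\boldsymbol c-\boldsymbol a_C\boldsymbol B_C)$ satisfying $2t+\delta\le n-k$, if such a codeword exists, and otherwise declares failure. Equivalently, it returns $\boldsymbol c$ exactly when $2(\mathrm{rk}(\boldsymbol r-\boldsymbol c)-\epsilon)+\delta\le n-k$, where $\epsilon$ is the dimension of the intersection of $\mathcal U$ with the row space of $\boldsymbol r-\boldsymbol c$ (the $\mathbb{F}_q$-row space in $\mathbb{F}_q^n$ of the $m\times n$ matrix over $\mathbb{F}_q$ obtained by expanding entries in an $\mathbb{F}_q$-basis of $\mathbb{F}_{q^m}$). Column-erasure-aided randomized decoder. Inputs: $\boldsymbol r$, an integer $\delta\in[2\xi,n-k]$, and $w$. In each iteration, choose a $\delta$-dimensional subspace $\mathcal U$ of $\mathbb{F}_q^n$ uniformly at random (independently over iterations), let $\boldsymbol B_C$ be a full-rank matrix with row space $\mathcal U$, and run the error-erasure decoder on $(\boldsymbol r,\boldsymbol B_C)$. If it returns a codeword $\hat{\boldsymbol c}$ with $\mathrm{rk}(\boldsymbol r-\hat{\boldsymbol c})\le w$, output $\hat{\boldsymbol c}$ and stop; otherwise go to the next iteration.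 Cost convention: each iteration (one call to the error-erasure decoder) is counted as $n^2$ operations over $\mathbb{F}_{q^m}$, and no cap on the number of iterations is imposed, so the average number of operations is $n^2$ times the expected number of iterations (over the random $\boldsymbol r$ and the random guesses). *)

theory Defs
  imports "HOL-Probability.Probability" "HOL-Library.Function_Algebras"
begin

text \<open>
  The fields \<open>\<bbbF>\<^sub>q\<close> and \<open>\<bbbF>\<^bsub>q^m\<^esub>\<close> are finite types \<^typ>\<open>'f\<close> and \<^typ>\<open>'e\<close>, joined by an
  embedding \<open>h\<close>.  Vectors of length \<open>n\<close> are of type \<open>'f ^ 'n\<close> and \<open>'e ^ 'n\<close> with \<open>n = CARD('n)\<close>.
\<close>

definition field_embedding :: "('f::field \<Rightarrow> 'e::field) \<Rightarrow> bool" where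
  "field_embedding h \<longleftrightarrow>
     h 1 = 1 \<and> (\<forall>x y. h (x + y) = h x + h y) \<and> (\<forall>x y. h (x * y) = h x * h y)"

definition ext_scale :: "('f::field \<Rightarrow> 'e::field) \<Rightarrow> 'f \<Rightarrow> 'e \<Rightarrow> 'e" where
  "ext_scale h c x = h c * x"

definition ext_degree :: "('f::field \<Rightarrow> 'e::field) \<Rightarrow> nat" where
  "ext_degree h = vector_space.dim (ext_scale h) (UNIV :: 'e set)"

definition rk :: "('f::field \<Rightarrow> 'e::field) \<Rightarrow> 'e ^ 'n \<Rightarrow> nat" where
  "rk h a = vector_space.dim (ext_scale h) (module.span (ext_scale h) (range (($) a)))"

definition entries_independent :: "('f::field \<Rightarrow> 'e::field) \<Rightarrow> 'e ^ 'n \<Rightarrow> bool" where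
  "entries_independent h g \<longleftrightarrow>
     inj (($) g) \<and> \<not> module.dependent (ext_scale h) (range (($) g))"

text \<open>Rows are numbered from 0, so that row \<open>i\<close> of the generator matrix has the entries \<open>g\<^sub>j ^ (q ^ i)\<close>.\<close>

definition Gab :: "nat \<Rightarrow> nat \<Rightarrow> 'e::field ^ 'n \<Rightarrow> ('e ^ 'n) set" where
  "Gab q k g = vec.span ((\<lambda>i. \<chi> j. g $ j ^ (q ^ i)) ` {..<k})"


section \<open>Error-erasure decoding\<close>

text \<open>
  A \<open>\<delta> \<times> n\<close> matrix is given by its rows \<open>B 0, \<dots>, B (\<delta> - 1)\<close>, and a vector in \<open>\<bbbF>\<^bsub>q^m\<^esub>\<close> of length \<open>\<delta>\<close>
  by its entries \<open>a 0, \<dots>, a (\<delta> - 1)\<close>; values at larger indices are irrelevant.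
\<close>

definition row_space :: "nat \<Rightarrow> (nat \<Rightarrow> 'f::field ^ 'n) \<Rightarrow> ('f ^ 'n) set" where
  "row_space \<delta> B = vec.span (B ` {..<\<delta>})"

definition full_row_rank :: "nat \<Rightarrow> (nat \<Rightarrow> 'f::field ^ 'n) \<Rightarrow> bool" where
  "full_row_rank \<delta> B \<longleftrightarrow> vec.dim (row_space \<delta> B) = \<delta>"

definition erasure_word ::
    "('f::field \<Rightarrow> 'e::field) \<Rightarrow> nat \<Rightarrow> (nat \<Rightarrow> 'e) \<Rightarrow> (nat \<Rightarrow> 'f ^ 'n) \<Rightarrow> 'e ^ 'n" where
  "erasure_word h \<delta> a B = (\<Sum>i<\<delta>. a i *s (\<chi> j. h (B i $ j)))"

definition ee_decodable ::
    "('f::{field,finite} \<Rightarrow> 'e::field) \<Rightarrow> nat \<Rightarrow> 'e ^ 'n \<Rightarrow> nat \<Rightarrow> (nat \<Rightarrow> 'f ^ 'n) \<Rightarrow> 'e ^ 'n \<Rightarrow> 'e ^ 'n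
      \<Rightarrow> bool" where
  "ee_decodable h k g \<delta> B r c \<longleftrightarrow>
     c \<in> Gab CARD('f) k g \<and>
     (\<exists>a. 2 * rk h (r - c - erasure_word h \<delta> a B) + \<delta> \<le> CARD('n) - k)"

text \<open>
  The choice is only apparent: a Gabidulin code has minimum rank distance \<open>n - k + 1\<close>, so for a
  matrix of full rank at most one codeword meets the condition.
\<close>

definition ee_decoder ::
    "('f::{field,finite} \<Rightarrow> 'e::field) \<Rightarrow> nat \<Rightarrow> 'e ^ 'n \<Rightarrow> nat \<Rightarrow> (nat \<Rightarrow> 'f ^ 'n) \<Rightarrow> 'e ^ 'n
      \<Rightarrow> ('e ^ 'n) option" where
  "ee_decoder h k g \<delta> B r =
     (if \<exists>c. ee_decodable h k g \<delta> B r c then Some (SOME c. ee_decodable h k g \<delta> B r c) else None)"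


section \<open>The column-erasure-aided randomized decoder\<close>

definition rd_iteration ::
    "('f::{field,finite} \<Rightarrow> 'e::field) \<Rightarrow> nat \<Rightarrow> 'e ^ 'n \<Rightarrow> nat \<Rightarrow> nat \<Rightarrow> (nat \<Rightarrow> 'f ^ 'n) \<Rightarrow> 'e ^ 'n
      \<Rightarrow> ('e ^ 'n) option" where
  "rd_iteration h k g \<delta> w B r =
     (case ee_decoder h k g \<delta> B r of
        None \<Rightarrow> None
      | Some c \<Rightarrow> if rk h (r - c) \<le> w then Some c else None)"

text \<open>
  The function \<open>\<B>\<close> assigns to each guessed space the matrix that is passed to the error-erasure
  decoder, and \<open>\<omega> !! t\<close> is the guess of iteration \<open>t\<close> (counted from 0).  The number of iterations
  is \<open>\<infinity>\<close> if no iteration returns a codeword.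
\<close>

definition rd_num_iterations ::
    "('f::{field,finite} \<Rightarrow> 'e::field) \<Rightarrow> nat \<Rightarrow> 'e ^ 'n \<Rightarrow> nat \<Rightarrow> nat \<Rightarrow>
      (('f ^ 'n) set \<Rightarrow> nat \<Rightarrow> 'f ^ 'n) \<Rightarrow> 'e ^ 'n \<Rightarrow> ('f ^ 'n) set stream \<Rightarrow> ennreal" where
  "rd_num_iterations h k g \<delta> w \<B> r \<omega> =
     (INF t \<in> {t. rd_iteration h k g \<delta> w (\<B> (\<omega> !! t)) r \<noteq> None}. of_nat (Suc t))"

definition guesses :: "nat \<Rightarrow> ('f::{field,finite} ^ 'n) set stream measure" where
  "guesses \<delta> = stream_space (measure_pmf (pmf_of_set {U. vec.subspace U \<and> vec.dim U = \<delta>}))"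

definition rd_average_operations ::
    "('f::{field,finite} \<Rightarrow> 'e::{field,finite}) \<Rightarrow> nat \<Rightarrow> 'e ^ 'n \<Rightarrow> nat \<Rightarrow> nat \<Rightarrow>
      (('f ^ 'n) set \<Rightarrow> nat \<Rightarrow> 'f ^ 'n) \<Rightarrow> ennreal" where
  "rd_average_operations h k g \<delta> w \<B> =
     of_nat (CARD('n)\<^sup>2) *
     (\<integral>\<^sup>+ (r, \<omega>). rd_num_iterations h k g \<delta> w \<B> r \<omega>
        \<partial>(measure_pmf (pmf_of_set UNIV) \<Otimes>\<^sub>M guesses \<delta>))"


section \<open>The work factor\<close>

text \<open>
  \<open>gauss_binom TYPE('f) a b\<close> is the Gaussian binomial coefficient for \<open>q = CARD('f)\<close>: it counts the
  \<open>b\<close>-dimensional subspaces of \<open>\<bbbF>\<^sub>q\<^sup>a\<close>, realised as the space of sequences supported on \<open>{..<a}\<close>.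
\<close>

definition seq_scale :: "'f::field \<Rightarrow> (nat \<Rightarrow> 'f) \<Rightarrow> nat \<Rightarrow> 'f" where
  "seq_scale c v = (\<lambda>i. c * v i)"

definition gauss_binom :: "'f::{field,finite} itself \<Rightarrow> nat \<Rightarrow> nat \<Rightarrow> nat" where
  "gauss_binom _ a b =
     card {V :: (nat \<Rightarrow> 'f) set. V \<subseteq> {v. \<forall>i\<ge>a. v i = 0} \<and>
       module.subspace seq_scale V \<and> vector_space.dim seq_scale V = b}"

text \<open>
  In the first case the lower summation bound is positive, so the coercion \<open>nat\<close> does not truncate;
  \<open>n - j\<close> does not truncate as long as \<open>j \<le> n\<close>, which holds wherever \<open>P_RD\<close> is used below.
\<close>

definition P_RD :: "'f::{field,finite} itself \<Rightarrow> nat \<Rightarrow> nat \<Rightarrow> nat \<Rightarrow> nat \<Rightarrow> real" where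
  "P_RD F n k \<delta> j =
     (if 2 * j + \<delta> > n - k
      then inverse (real (gauss_binom F n \<delta>)) *
        (\<Sum>i = nat \<lceil>real j - (real n - real k) / 2 + real \<delta> / 2\<rceil>..min \<delta> j.
           real (gauss_binom F (n - j) (\<delta> - i)) * real (gauss_binom F j i) *
           real CARD('f) ^ ((j - i) * (\<delta> - i)))
      else 1)"

definition A_bar :: "nat \<Rightarrow> nat \<Rightarrow> nat \<Rightarrow> nat \<Rightarrow> nat \<Rightarrow> real" where
  "A_bar q m n k j =
     real q powi (int m * (int k - int n)) *
     (\<Prod>i<j. (real q ^ m - real q ^ i) * (real q ^ n - real q ^ i) / (real q ^ j - real q ^ i))"

definition xi :: "nat \<Rightarrow> nat \<Rightarrow> nat \<Rightarrow> real" where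
  "xi n k w = real w - (real n - real k) / 2"

definition erasure_range :: "nat \<Rightarrow> nat \<Rightarrow> nat \<Rightarrow> nat set" where
  "erasure_range n k w = {\<delta>. 2 * xi n k w \<le> real \<delta> \<and> \<delta> \<le> n - k}"

text \<open>
  The infimum ranges over a finite set, hence is a minimum; it is \<open>\<infinity>\<close> if that set is empty, that is,
  if \<open>w > n - k\<close>.
\<close>

definition W_RD :: "'f::{field,finite} itself \<Rightarrow> nat \<Rightarrow> nat \<Rightarrow> nat \<Rightarrow> nat \<Rightarrow> ennreal" where
  "W_RD F m n k w =
     (INF \<delta> \<in> erasure_range n k w.
        ennreal ((real n)\<^sup>2 / (\<Sum>j = 0..w. A_bar CARD('f) m n k j * P_RD F n k \<delta> j)))"

end

theory Submission
  imports Defs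
begin

text \<open>
  For a fixed received word \<open>r\<close> the number of iterations is geometric with the success probability
  \<open>p\<^sub>r\<close> of one guess, so its mean is \<open>1/p\<^sub>r\<close>, and by Jensen's inequality the average over \<open>r\<close> is at
  least \<open>1/E[p\<^sub>r]\<close>.  A union bound over the at most \<open>q^(mk)\<close> codewords \<open>c\<close>, with the error \<open>e = r - c\<close>
  sorted by rank, bounds \<open>E[p\<^sub>r]\<close> by the sum in the definition of \<open>W_RD\<close>: an error with row space
  \<open>R\<close> of dimension \<open>j\<close> can be decoded with guess \<open>U\<close> only if \<open>2 (j - dim (U \<inter> R)) + \<delta> \<le> n - k\<close>.

  For the closed form, \<open>q^(b(a-b)) \<le> gauss_binom a b \<le> 4 q^(b(a-b))\<close> bounds each summand of the
  resulting double sum by 64 times a power of \<open>q\<close>.  The exponent decreases by at least 2 per step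
  away from \<open>j = w\<close> and from the least admissible \<open>i\<close>, so the whole sum is at most \<open>64 (4/3)\<^sup>2\<close> times
  the dominating power.  Its exponent is governed by a concave quadratic in \<open>\<delta>\<close>, which is minimal at
  an endpoint of \<open>[2\<xi>, n - k]\<close>; the endpoints yield the two arguments of the minimum.
\<close>

section \<open>Counting subspaces over a finite field\<close>

locale finite_field_vector_space = vector_space scale
  for scale :: "'a::{field,finite} \<Rightarrow> 'b::ab_group_add \<Rightarrow> 'b" (infixr \<open>*s\<close> 75)
begin

text \<open>The map \<open>(c, s) \<mapsto> c x + s\<close> is a bijection onto the new span: if two
  images agree with \<open>c \<noteq> d\<close>, dividing by \<open>c - d\<close> puts
  \<open>x\<close> into \<open>span S\<close>.\<close>

lemma card_span_insert:
  assumes fin: "finite (span S)" and x: "x \<notin> span S"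
  shows "finite (span (insert x S))" "card (span (insert x S)) = CARD('a) * card (span S)"
proof -
  let ?f = "\<lambda>(c, s). c *s x + s"
  have "inj_on ?f (UNIV \<times> span S)"
  proof (rule inj_onI, clarsimp)
    fix c s d t assume s: "s \<in> span S" and t: "t \<in> span S" and eq: "c *s x + s = d *s x + t"
    have "(c - d) *s x = t - s"
      using eq by (simp add: scale_left_diff_distrib algebra_simps)
    hence "(c - d) *s x \<in> span S" using s t by (simp add: span_diff)
    hence "c = d"
      using x span_scale[of "(c - d) *s x" S "inverse (c - d)"] by (cases "c = d") auto
    thus "c = d \<and> s = t" using eq by simp
  qed
  moreover have "?f ` (UNIV \<times> span S) = span (insert x S)"
  proof (rule set_eqI, rule iffI)
    fix y assume "y \<in> ?f ` (UNIV \<times> span S)"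
    then obtain c s where "y = c *s x + s" "s \<in> span S" by auto
    thus "y \<in> span (insert x S)" unfolding span_breakdown_eq by (auto intro!: exI[of _ c])
  next
    fix y assume "y \<in> span (insert x S)"
    then obtain c where "y - c *s x \<in> span S" unfolding span_breakdown_eq by auto
    thus "y \<in> ?f ` (UNIV \<times> span S)"
      by (intro image_eqI[of _ _ "(c, y - c *s x)"]) auto
  qed
  ultimately have bij: "bij_betw ?f (UNIV \<times> span S) (span (insert x S))"
    by (simp add: bij_betw_def)
  show "finite (span (insert x S))" using bij_betw_finite[OF bij] fin by simp
  show "card (span (insert x S)) = CARD('a) * card (span S)"
    using bij_betw_same_card[OF bij] by (simp add: card_cartesian_product)
qed

lemma finite_span: "finite S \<Longrightarrow> finite (span S)"
proof (induction S rule: finite_induct)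
  case (insert x S)
  thus ?case by (cases "x \<in> span S") (simp_all add: span_redundant card_span_insert(1))
qed simp

lemma card_span_le: "finite S \<Longrightarrow> card (span S) \<le> CARD('a) ^ card S"
proof (induction S rule: finite_induct)
  case (insert x S)
  have "card (span S) \<le> CARD('a) * card (span S)"
    by (simp add: Suc_le_eq)
  thus ?case using insert
    by (cases "x \<in> span S")
      (auto simp: span_redundant card_span_insert(2) finite_span intro: le_trans)
qed simp

lemma card_span_independent: "finite B \<Longrightarrow> independent B \<Longrightarrow> card (span B) = CARD('a) ^ card B"
  by (induction B rule: finite_induct) (auto simp: independent_insert card_span_insert(2) finite_span)

lemma card_subspace:
  assumes "subspace V" "finite V"
  shows "card V = CARD('a) ^ dim V"
proof -
  obtain B where B: "B \<subseteq> V" "independent B" "V \<subseteq> span B" "card B = dim V"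
    using basis_exists by blast
  have "finite B" using B(1) assms(2) finite_subset by blast
  moreover have "span B = V" using B assms(1) by (simp add: span_subspace)
  ultimately show ?thesis using card_span_independent B by metis
qed

lemma two_le_card_field: "2 \<le> CARD('a)"
proof -
  have "card {0, 1 :: 'a} \<le> CARD('a)" by (rule card_mono) auto
  thus ?thesis by simp
qed

text \<open>Since \<open>q \<ge> 2\<close>, the value of \<open>q ^ d\<close> determines
  \<open>d\<close>, so dimensions can be read off from cardinalities without exhibiting a
  basis.\<close>

lemma dim_eqI:
  assumes "subspace V" "finite V" "card V = CARD('a) ^ d"
  shows "dim V = d"
  using card_subspace[OF assms(1,2)] assms(3) two_le_card_field by simp

text \<open>Linear independence modulo \<open>R\<close>, on lists rather than sets because ordered
  bases are counted.\<close>

primrec indep_over :: "'b set \<Rightarrow> 'b list \<Rightarrow> bool" where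
  "indep_over R [] \<longleftrightarrow> True"
| "indep_over R (x # xs) \<longleftrightarrow> x \<notin> span (R \<union> set xs) \<and> indep_over R xs"

lemma card_span_indep_over:
  assumes "finite (span R)" "indep_over R xs"
  shows "finite (span (R \<union> set xs)) \<and>
    card (span (R \<union> set xs)) = card (span R) * CARD('a) ^ length xs"
  using assms(2) by (induction xs) (use assms(1) in \<open>auto simp: card_span_insert\<close>)

lemma card_span_Un_indep_over:
  assumes "subspace R" "finite R" "indep_over R xs"
  shows "card (span (R \<union> set xs)) = card R * CARD('a) ^ length xs"
proof -
  have "span R = R" using assms(1) by simp
  note * = this
  show ?thesis using card_span_indep_over[of R xs, unfolded *] assms(2,3) by blast
qed

section \<open>Ordered bases and the number of subspaces\<close>

definition indep_lists :: "'b set \<Rightarrow> 'b set \<Rightarrow> nat \<Rightarrow> 'b list set" where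
  "indep_lists R V l = {xs. length xs = l \<and> set xs \<subseteq> V \<and> indep_over R xs}"

lemma indep_lists_0: "indep_lists R V 0 = {[]}"
  by (auto simp: indep_lists_def)

lemma finite_indep_lists: "finite V \<Longrightarrow> finite (indep_lists R V l)"
  by (rule finite_subset[OF _ finite_lists_length_eq[of V l]]) (auto simp: indep_lists_def)

text \<open>Each list of length \<open>l\<close> spans together with \<open>R\<close> a space of
  \<open>q ^ (dim R + l)\<close> elements, so all lists have equally many one-vector extensions. The
  real product is also right for large \<open>l\<close>, since the factor with
  \<open>dim R + i = dim V\<close> vanishes.\<close>

lemma card_indep_lists:
  assumes V: "subspace V" "finite V" and R: "subspace R" "R \<subseteq> V"
  shows "real (card (indep_lists R V l)) =
    (\<Prod>i<l. real CARD('a) ^ dim V - real CARD('a) ^ (dim R + i))"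
proof (induction l)
  case 0
  show ?case by (simp add: indep_lists_0)
next
  case (Suc l)
  let ?q = "real CARD('a)"
  have finR: "finite R" using R V finite_subset by blast
  have sub: "span (R \<union> set xs) \<subseteq> V" if "xs \<in> indep_lists R V l" for xs
    using that R V by (intro span_minimal) (auto simp: indep_lists_def)
  have c: "real (card (V - span (R \<union> set xs))) = ?q ^ dim V - ?q ^ (dim R + l)"
    if xs: "xs \<in> indep_lists R V l" for xs
  proof -
    have "card (span (R \<union> set xs)) = card R * CARD('a) ^ l"
      using card_span_Un_indep_over[of R xs] xs finR R(1) by (simp add: indep_lists_def)
    hence "card (span (R \<union> set xs)) = CARD('a) ^ (dim R + l)"
      using card_subspace[OF R(1) finR] by (simp add: power_add)
    thus ?thesis using card_mono[OF V(2) sub[OF xs]] sub[OF xs] card_subspace[OF V]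
      by (simp add: card_Diff_subset finite_subset[OF _ V(2)] of_nat_diff)
  qed
  have "indep_lists R V (Suc l) =
      (\<lambda>(xs, x). x # xs) ` (SIGMA xs:indep_lists R V l. V - span (R \<union> set xs))"
    by (force simp: indep_lists_def length_Suc_conv image_iff)
  hence "card (indep_lists R V (Suc l)) =
      card (SIGMA xs:indep_lists R V l. V - span (R \<union> set xs))"
    by (simp add: card_image inj_on_def split_beta)
  also have "\<dots> = (\<Sum>xs\<in>indep_lists R V l. card (V - span (R \<union> set xs)))"
    using V by (intro card_SigmaI) (auto simp: finite_indep_lists)
  finally have "real (card (indep_lists R V (Suc l))) =
      (\<Sum>xs\<in>indep_lists R V l. ?q ^ dim V - ?q ^ (dim R + l))"
    using c by simp
  thus ?case using Suc by (simp add: mult.commute)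
qed

text \<open>Dedekind's modular law: if \<open>a + b\<close> lies in \<open>U\<close> and
  \<open>b\<close> in \<open>span Y \<subseteq> U\<close>, then \<open>a\<close> lies in
  \<open>U\<close> as well.\<close>

lemma span_Un_Int:
  assumes "subspace U" "subspace R" "Y \<subseteq> U"
  shows "span (R \<union> Y) \<inter> U = span ((U \<inter> R) \<union> Y)"
proof
  show "span ((U \<inter> R) \<union> Y) \<subseteq> span (R \<union> Y) \<inter> U"
  proof (rule Int_greatest)
    show "span ((U \<inter> R) \<union> Y) \<subseteq> span (R \<union> Y)" by (rule span_mono) auto
    show "span ((U \<inter> R) \<union> Y) \<subseteq> U" using assms by (intro span_minimal) auto
  qed
next
  have Y: "span Y \<subseteq> U" using assms by (simp add: span_minimal)
  show "span (R \<union> Y) \<inter> U \<subseteq> span ((U \<inter> R) \<union> Y)"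
  proof
    fix x assume "x \<in> span (R \<union> Y) \<inter> U"
    hence "x \<in> {a + b |a b. a \<in> span R \<and> b \<in> span Y}" "x \<in> U"
      by (simp_all only: span_Un Int_iff)
    then obtain a b where ab: "x = a + b" "a \<in> span R" "b \<in> span Y" "x \<in> U" by blast
    have "a \<in> R" using ab(2) span_minimal[OF order_refl assms(2)] by blast
    have "x - b \<in> U" using ab Y assms(1) subspace_diff by blast
    hence "a \<in> U \<inter> R" using ab \<open>a \<in> R\<close> by simp
    hence "a \<in> span ((U \<inter> R) \<union> Y)" by (simp add: span_base)
    moreover have "b \<in> span ((U \<inter> R) \<union> Y)" using ab(3) span_mono[of Y] by blast
    ultimately show "x \<in> span ((U \<inter> R) \<union> Y)" using ab(1) span_add by simp
  qed
qed

text \<open>By the modular law the two spans tested at each list entry have the same vectors inside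
  \<open>U\<close>.\<close>

lemma indep_over_Int:
  assumes "subspace U" "subspace R" "set ys \<subseteq> U"
  shows "indep_over (U \<inter> R) ys \<longleftrightarrow> indep_over R ys"
  using assms(3)
proof (induction ys)
  case (Cons y ys)
  thus ?case using span_Un_Int[OF assms(1,2), of "set ys"] by auto
qed simp

text \<open>Double counting of ordered bases: a list of \<open>b\<close> independent vectors is a
  basis of exactly one \<open>b\<close>-dimensional subspace, its span.\<close>

lemma card_subspaces_of_dim:
  assumes V: "subspace V" "finite V"
  shows "real (card {U. subspace U \<and> U \<subseteq> V \<and> dim U = b}) *
      (\<Prod>l<b. real CARD('a) ^ b - real CARD('a) ^ l) =
    (\<Prod>l<b. real CARD('a) ^ dim V - real CARD('a) ^ l)" (is "real (card ?S) * ?P = ?Q")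
proof -
  have z: "subspace {0}" "{0} \<subseteq> V" using V by (auto simp: subspace_0)
  have dz: "dim {0} = 0" by (rule dim_eqI) auto
  have eq: "indep_lists {0} V b = (\<Union>U\<in>?S. indep_lists {0} U b)"
  proof (intro equalityI subsetI)
    fix xs assume xs: "xs \<in> indep_lists {0} V b"
    let ?U = "span (set xs)"
    have "?U \<subseteq> V" using xs V by (intro span_minimal) (auto simp: indep_lists_def)
    moreover have "card ?U = CARD('a) ^ b"
      using card_span_indep_over[of "{0}" xs] xs by (auto simp: indep_lists_def)
    ultimately have "?U \<in> ?S" using dim_eqI[of ?U b] V finite_subset by auto
    moreover have "xs \<in> indep_lists {0} ?U b" using xs by (auto simp: indep_lists_def span_base)
    ultimately show "xs \<in> (\<Union>U\<in>?S. indep_lists {0} U b)" by blast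
  qed (auto simp: indep_lists_def)
  have spanU: "span (set xs) = U" if "U \<in> ?S" "xs \<in> indep_lists {0} U b" for U xs
  proof (rule card_subset_eq)
    show "finite U" using that V finite_subset by auto
    show "span (set xs) \<subseteq> U" using that by (intro span_minimal) (auto simp: indep_lists_def)
    have "card (span (set xs)) = CARD('a) ^ b"
      using card_span_indep_over[of "{0}" xs] that by (auto simp: indep_lists_def)
    thus "card (span (set xs)) = card U"
      using that card_subspace[of U] \<open>finite U\<close> by auto
  qed
  have finS: "finite ?S" by (rule finite_subset[of _ "Pow V"]) (use V in auto)
  have "card (indep_lists {0} V b) = (\<Sum>U\<in>?S. card (indep_lists {0} U b))"
    unfolding eq
  proof (rule card_UN_disjoint[OF finS])
    show "\<forall>U\<in>?S. finite (indep_lists {0} U b)"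
    proof
      fix U assume "U \<in> ?S"
      hence "finite U" using V finite_subset by blast
      thus "finite (indep_lists {0} U b)" by (rule finite_indep_lists)
    qed
    show "\<forall>U\<in>?S. \<forall>U'\<in>?S. U \<noteq> U' \<longrightarrow> indep_lists {0} U b \<inter> indep_lists {0} U' b = {}"
    proof (intro ballI impI equals0I)
      fix U U' xs assume U: "U \<in> ?S" "U' \<in> ?S" "U \<noteq> U'"
        and xs: "xs \<in> indep_lists {0} U b \<inter> indep_lists {0} U' b"
      have "span (set xs) = U" "span (set xs) = U'"
        by (rule spanU; use U xs in blast)+
      thus False using U(3) by simp
    qed
  qed
  also have "real \<dots> = (\<Sum>U\<in>?S. ?P)"
    unfolding of_nat_sum
  proof (rule sum.cong[OF refl])
    fix U assume "U \<in> ?S"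
    hence "subspace U" "finite U" "{0} \<subseteq> U" "dim U = b"
      using V finite_subset[of U V] by (auto simp: subspace_0)
    thus "real (card (indep_lists {0} U b)) = ?P"
      using card_indep_lists[of U "{0}" b] z dz by simp
  qed
  finally show ?thesis using card_indep_lists[OF V z, of b] dz by simp
qed

text \<open>
  Double counting of bases of \<open>U\<close> that extend a basis of \<open>U \<inter> R\<close>: the additional vectors are
  independent modulo \<open>U \<inter> R\<close> iff they are independent modulo \<open>R\<close>.
\<close>

lemma card_subspaces_of_dim_Int_le:
  assumes V: "subspace V" "finite V" and R: "subspace R" "R \<subseteq> V" and i: "i \<le> d"
  shows "real (card {U. subspace U \<and> U \<subseteq> V \<and> dim U = d \<and> dim (U \<inter> R) = i}) *
      ((\<Prod>l<i. real CARD('a) ^ i - real CARD('a) ^ l) *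
       (\<Prod>l<d - i. real CARD('a) ^ d - real CARD('a) ^ (i + l))) \<le>
    (\<Prod>l<i. real CARD('a) ^ dim R - real CARD('a) ^ l) *
    (\<Prod>l<d - i. real CARD('a) ^ dim V - real CARD('a) ^ (dim R + l))"
    (is "real (card ?S) * ?P \<le> ?Q")
proof -
  have finR: "finite R" using R V finite_subset by blast
  have dz: "dim {0} = 0" by (rule dim_eqI) auto
  \<comment> \<open>Pairs of an ordered basis of \<open>U \<inter> R\<close> and a list completing
    it to a basis of \<open>U\<close>. A pair determines \<open>U\<close> as its span, so the sets
    \<open>L U\<close> are disjoint.\<close>
  define L where "L U = indep_lists {0} (U \<inter> R) i \<times> indep_lists (U \<inter> R) U (d - i)" for U
  have finS: "finite ?S" by (rule finite_subset[of _ "Pow V"]) (use V in auto)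
  have finL: "finite (L U)" if "U \<in> ?S" for U
    using that V finite_subset[of U V] by (auto simp: L_def intro!: finite_indep_lists)
  have spanU: "span (set (fst p) \<union> set (snd p)) = U" if U: "U \<in> ?S" and p: "p \<in> L U" for U p
  proof -
    obtain xs ys where [simp]: "p = (xs, ys)" by force
    have fU: "finite U" using that V finite_subset by auto
    have sU: "subspace (U \<inter> R)" using U R by (simp add: subspace_inter)
    have xs: "xs \<in> indep_lists {0} (U \<inter> R) i" and ys: "ys \<in> indep_lists (U \<inter> R) U (d - i)"
      using p by (auto simp: L_def)
    have 1: "span (set xs) = U \<inter> R"
    proof (rule card_subset_eq)
      show "finite (U \<inter> R)" using fU by simp
      show "span (set xs) \<subseteq> U \<inter> R"
        using xs sU by (intro span_minimal) (auto simp: indep_lists_def)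
      show "card (span (set xs)) = card (U \<inter> R)"
        using card_span_indep_over[of "{0}" xs] xs card_subspace[OF sU] fU U
        by (auto simp: indep_lists_def)
    qed
    have 2: "span (U \<inter> R \<union> set ys) = U"
    proof (rule card_subset_eq)
      show "finite U" by fact
      show "span (U \<inter> R \<union> set ys) \<subseteq> U"
        using ys U by (intro span_minimal) (auto simp: indep_lists_def)
      have "card (span (U \<inter> R \<union> set ys)) = card (U \<inter> R) * CARD('a) ^ (d - i)"
        using card_span_Un_indep_over[of "U \<inter> R" ys] ys fU sU by (simp add: indep_lists_def)
      also have "\<dots> = CARD('a) ^ (i + (d - i))"
        using card_subspace[OF sU] fU U by (simp add: power_add)
      also have "\<dots> = card U" using card_subspace[of U] fU U i by simp
      finally show "card (span (U \<inter> R \<union> set ys)) = card U" .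
    qed
    have "span (set xs \<union> set ys) = span (span (set xs) \<union> set ys)"
      unfolding span_Un span_span ..
    thus ?thesis using 1 2 by simp
  qed
  have card_L: "real (card (L U)) = ?P" if "U \<in> ?S" for U
  proof -
    have fU: "finite U" using that V finite_subset by auto
    have sU: "subspace (U \<inter> R)" using that R by (simp add: subspace_inter)
    have 1: "real (card (indep_lists {0} (U \<inter> R) i)) = (\<Prod>l<i. real CARD('a) ^ i - real CARD('a) ^ l)"
      using card_indep_lists[OF sU, of "{0}" i] fU subspace_0[OF sU] dz that by simp
    have 2: "real (card (indep_lists (U \<inter> R) U (d - i))) =
        (\<Prod>l<d - i. real CARD('a) ^ d - real CARD('a) ^ (i + l))"
      using card_indep_lists[of U "U \<inter> R" "d - i"] fU sU that by simp
    show ?thesis by (simp add: L_def card_cartesian_product 1 2)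
  qed
  have "real (card ?S) * ?P = (\<Sum>U\<in>?S. real (card (L U)))" using card_L by simp
  also have "\<dots> = real (card (\<Union>U\<in>?S. L U))"
  proof -
    have "card (\<Union>U\<in>?S. L U) = (\<Sum>U\<in>?S. card (L U))"
    proof (rule card_UN_disjoint[OF finS], use finL in blast, intro ballI impI)
      fix U U' assume U: "U \<in> ?S" "U' \<in> ?S" "U \<noteq> U'"
      show "L U \<inter> L U' = {}"
      proof (rule ccontr)
        assume "L U \<inter> L U' \<noteq> {}"
        then obtain p where "p \<in> L U" "p \<in> L U'" by blast
        thus False using spanU[OF U(1)] spanU[OF U(2)] U(3) by metis
      qed
    qed
    thus ?thesis by simp
  qed
  also have "\<dots> \<le> real (card (indep_lists {0} R i \<times> indep_lists R V (d - i)))"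
  proof -
    \<comment> \<open>Here independence modulo \<open>U \<inter> R\<close> becomes independence
      modulo \<open>R\<close>, so all \<open>L U\<close> lie in one set that no longer depends on
      \<open>U\<close>.\<close>
    have "L U \<subseteq> indep_lists {0} R i \<times> indep_lists R V (d - i)" if U: "U \<in> ?S" for U
      using U indep_over_Int[of U R] R unfolding L_def indep_lists_def by blast
    thus ?thesis
      using finR V by (intro of_nat_mono card_mono) (auto intro!: finite_indep_lists)
  qed
  also have "\<dots> = ?Q"
    using card_indep_lists[OF V R] card_indep_lists[OF R(1) finR, of "{0}"] subspace_0[OF R(1)] dz
    by (simp add: card_cartesian_product)
  finally show ?thesis .
qed

end

section \<open>Gaussian binomials and matrices of given rank\<close>

text \<open>For \<open>q\<close> the field size and \<open>b \<le> a\<close>, the number of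
  \<open>b\<close>-tuples of independent vectors in dimension \<open>a\<close>; dividing by
  \<open>q_falling q b b\<close> gives the Gaussian binomial. It vanishes for \<open>b > a\<close>
  through the factor \<open>l = a\<close>.\<close>

definition q_falling :: "real \<Rightarrow> nat \<Rightarrow> nat \<Rightarrow> real" where
  "q_falling q a b = (\<Prod>l<b. q ^ a - q ^ l)"

lemma q_falling_pos: "q > 1 \<Longrightarrow> b \<le> a \<Longrightarrow> q_falling q a b > 0"
  unfolding q_falling_def by (intro prod_pos) auto

lemma q_falling_0: "q_falling q a 0 = 1"
  by (simp add: q_falling_def)

lemma q_falling_Suc: "q_falling q a (Suc b) = q_falling q a b * (q ^ a - q ^ b)"
  by (simp add: q_falling_def)

lemma q_falling_Suc_Suc: "q_falling q (Suc a) (Suc b) = (q ^ Suc a - 1) * q ^ b * q_falling q a b"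
proof -
  have "(\<Prod>l<b. q ^ Suc a - q ^ Suc l) = q ^ b * (\<Prod>l<b. q ^ a - q ^ l)"
    by (simp add: prod.distrib flip: right_diff_distrib)
  thus ?thesis unfolding q_falling_def prod.lessThan_Suc_shift by simp
qed

lemma q_falling_shift: "(\<Prod>l<b. q ^ (c + a) - q ^ (c + l)) = q ^ (c * b) * q_falling q a b"
  by (simp add: q_falling_def power_add prod.distrib power_mult flip: right_diff_distrib)

context finite_field_vector_space
begin

lemma dim_insert_if:
  assumes "finite A"
  shows "dim (insert y A) = (if y \<in> span A then dim A else Suc (dim A))"
proof (cases "y \<in> span A")
  case True
  thus ?thesis using span_eq_dim[OF span_redundant[OF True]] by simp
next
  case False
  have "card (span A) = CARD('a) ^ dim A"
    using card_subspace[of "span A"] finite_span[OF assms] by simp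
  hence "dim (span (insert y A)) = Suc (dim A)"
    using card_span_insert[OF finite_span[OF assms] False] by (intro dim_eqI) auto
  thus ?thesis using False by simp
qed

text \<open>This counts matrices of rank \<open>j\<close>, adding one row at a time: a new row
  either lies in the span of the earlier ones or raises the rank by one.\<close>

lemma card_PiE_dim_image:
  assumes V: "subspace V" "finite V" and S: "finite S"
  shows "real (card {f \<in> S \<rightarrow>\<^sub>E V. dim (f ` S) = j}) * q_falling (real CARD('a)) j j =
    q_falling (real CARD('a)) (dim V) j * q_falling (real CARD('a)) (card S) j"
  using S
proof (induction S arbitrary: j rule: finite_induct)
  case empty
  have "dim {} = 0" using dim_eqI[of "{0}" 0] dim_span[of "{}"] by simp
  hence "{f \<in> {} \<rightarrow>\<^sub>E V. dim (f ` {}) = j} = (if j = 0 then {\<lambda>_. undefined} else {})" by auto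
  \<comment> \<open>The factor \<open>l = 0\<close> is \<open>1 - 1 = 0\<close> as soon as
    \<open>j > 0\<close>.\<close>
  moreover have "q_falling (real CARD('a)) 0 j = (if j = 0 then 1 else 0)"
    by (cases j) (simp_all add: q_falling_def prod.lessThan_Suc_shift del: prod.lessThan_Suc)
  ultimately show ?case by (auto simp: q_falling_0 \<open>dim {} = 0\<close>)
next
  case (insert x S)
  let ?q = "real CARD('a)"
  define N where "N i = real (card {f \<in> S \<rightarrow>\<^sub>E V. dim (f ` S) = i})" for i
  have fin: "finite (S \<rightarrow>\<^sub>E V)" using insert V by (simp add: finite_PiE)
  have cy: "real (card {y \<in> V. dim (insert y (g ` S)) = j}) =
      (if dim (g ` S) = j then ?q ^ j else if Suc (dim (g ` S)) = j then ?q ^ dim V - ?q ^ dim (g ` S) else 0)"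
    if g: "g \<in> S \<rightarrow>\<^sub>E V" for g
  proof -
    have fg: "finite (g ` S)" using insert by simp
    have sub: "span (g ` S) \<subseteq> V" using g V by (intro span_minimal) auto
    have cs: "card (span (g ` S)) = CARD('a) ^ dim (g ` S)"
      using card_subspace[of "span (g ` S)"] finite_span[OF fg] by simp
    have "{y \<in> V. dim (insert y (g ` S)) = j} =
      (if dim (g ` S) = j then span (g ` S) else if Suc (dim (g ` S)) = j then V - span (g ` S) else {})"
      using sub dim_insert_if[OF fg] by auto
    moreover have "real (card (V - span (g ` S))) = ?q ^ dim V - ?q ^ dim (g ` S)"
      using card_mono[OF V(2) sub] sub cs card_subspace[OF V]
      by (simp add: card_Diff_subset finite_subset[OF _ V(2)] of_nat_diff)
    ultimately show ?thesis using cs by auto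
  qed
  have "{f \<in> insert x S \<rightarrow>\<^sub>E V. dim (f ` insert x S) = j} =
      (\<lambda>(g, y). g(x := y)) ` (SIGMA g:S \<rightarrow>\<^sub>E V. {y \<in> V. dim (insert y (g ` S)) = j})" (is "?A = ?f ` ?B")
  proof -
    have im: "?f p ` insert x S = insert (snd p) (fst p ` S)" for p :: "('c \<Rightarrow> 'b) \<times> 'b"
      using insert by (auto simp: split_beta)
    have "insert x S \<rightarrow>\<^sub>E V = ?f ` ((S \<rightarrow>\<^sub>E V) \<times> V)"
      unfolding PiE_insert_eq by force
    hence "?A = {f \<in> ?f ` ((S \<rightarrow>\<^sub>E V) \<times> V). dim (f ` insert x S) = j}" by simp
    also have "\<dots> = ?f ` {p \<in> (S \<rightarrow>\<^sub>E V) \<times> V. dim (?f p ` insert x S) = j}" by blast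
    also have "{p \<in> (S \<rightarrow>\<^sub>E V) \<times> V. dim (?f p ` insert x S) = j} = ?B"
      unfolding im by auto
    finally show ?thesis .
  qed
  moreover have "inj_on ?f ?B"
  proof (rule inj_onI, clarsimp)
    fix g y g' y' assume g: "g \<in> S \<rightarrow>\<^sub>E V" "g' \<in> S \<rightarrow>\<^sub>E V" and eq: "g(x := y) = g'(x := y')"
    have "g z = g' z" for z
      using fun_cong[OF eq, of z] insert(2) PiE_arb[OF g(1), of x] PiE_arb[OF g(2), of x]
      by (cases "z = x") auto
    thus "g = g' \<and> y = y'" using fun_cong[OF eq, of x] by auto
  qed
  ultimately have "card ?A = card ?B" by (simp add: card_image)
  also have "\<dots> = (\<Sum>g\<in>S \<rightarrow>\<^sub>E V. card {y \<in> V. dim (insert y (g ` S)) = j})"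
    using fin V by (intro card_SigmaI) auto
  finally have "real (card ?A) = (\<Sum>g\<in>S \<rightarrow>\<^sub>E V. (if dim (g ` S) = j then ?q ^ j
      else if Suc (dim (g ` S)) = j then ?q ^ dim V - ?q ^ dim (g ` S) else 0))"
    using cy by simp
  \<comment> \<open>Where the rank rises to \<open>j\<close>, the old rank is \<open>j - 1\<close>,
    so the summands become constants. For \<open>j = 0\<close> that case is empty and the truncated
    \<open>j - 1\<close> does no harm.\<close>
  also have "\<dots> = (\<Sum>g\<in>S \<rightarrow>\<^sub>E V. (if dim (g ` S) = j then ?q ^ j else 0) +
      (if Suc (dim (g ` S)) = j then ?q ^ dim V - ?q ^ (j - 1) else 0))"
    by (intro sum.cong) auto
  also have "\<dots> = N j * ?q ^ j +
      real (card {g \<in> S \<rightarrow>\<^sub>E V. Suc (dim (g ` S)) = j}) * (?q ^ dim V - ?q ^ (j - 1))"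
    using fin by (simp add: sum.distrib N_def flip: sum.inter_filter)
  finally have A: "real (card ?A) = N j * ?q ^ j +
      real (card {g \<in> S \<rightarrow>\<^sub>E V. Suc (dim (g ` S)) = j}) * (?q ^ dim V - ?q ^ (j - 1))" .
  show ?case
  proof (cases j)
    case 0
    thus ?thesis using A insert.IH[of 0] by (simp add: N_def q_falling_0)
  next
    case (Suc i)
    let ?F = "q_falling ?q"
    have IH: "N i * ?F i i = ?F (dim V) i * ?F (card S) i" for i
      using insert.IH[of i] by (simp add: N_def)
    have "real (card ?A) * ?F (Suc i) (Suc i) =
        ?q ^ Suc i * (N (Suc i) * ?F (Suc i) (Suc i)) + (?q ^ dim V - ?q ^ i) * N i * ?F (Suc i) (Suc i)"
      using A unfolding Suc by (simp only: N_def diff_Suc_1 nat.inject) (simp add: algebra_simps)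
    also have "\<dots> = ?q ^ Suc i * (?F (dim V) (Suc i) * ?F (card S) (Suc i)) +
        (?q ^ dim V - ?q ^ i) * (N i * ?F i i) * ((?q ^ Suc i - 1) * ?q ^ i)"
      by (simp only: IH[of "Suc i", symmetric]) (simp add: q_falling_Suc_Suc[of ?q i i] algebra_simps)
    \<comment> \<open>With \<open>s = card S\<close>, the summands combine by
      \<open>q^(i+1) (q^s - q^i) + (q^(i+1) - 1) q^i = q^i (q^(s+1) - 1)\<close>.\<close>
    also have "\<dots> = ?F (dim V) (Suc i) * ((?q ^ Suc (card S) - 1) * ?q ^ i * ?F (card S) i)"
      unfolding IH[of i] q_falling_Suc by (simp add: algebra_simps)
    finally show ?thesis
      unfolding Suc card_insert_disjoint[OF insert(1,2)] q_falling_Suc_Suc[of ?q "card S"] .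
  qed
qed

end

section \<open>Instances: coordinate vectors, the extension field, sequences\<close>

lemma finite_field_vector_space_vec:
  "finite_field_vector_space ((*s) :: 'f::{field,finite} \<Rightarrow> 'f ^ 'n \<Rightarrow> 'f ^ 'n)"
  by (rule finite_field_vector_space.intro) (rule vec.vector_space_axioms)

lemma vector_space_ext_scale:
  assumes "field_embedding h"
  shows "vector_space (ext_scale h)"
  using assms by unfold_locales (auto simp: field_embedding_def ext_scale_def algebra_simps)

lemma finite_field_vector_space_ext_scale:
  "field_embedding (h :: 'f::{field,finite} \<Rightarrow> 'e::field) \<Longrightarrow> finite_field_vector_space (ext_scale h)"
  by (intro finite_field_vector_space.intro vector_space_ext_scale)

lemma finite_field_vector_space_seq_scale:
  "finite_field_vector_space (seq_scale :: 'f::{field,finite} \<Rightarrow> _)"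
  by (intro finite_field_vector_space.intro, unfold_locales)
    (auto simp: seq_scale_def algebra_simps fun_eq_iff)

lemma real_card_field_gt_1: "1 < real CARD('f::{field,finite})"
proof -
  interpret finite_field_vector_space "(*s) :: 'f \<Rightarrow> 'f ^ 1 \<Rightarrow> 'f ^ 1"
    by (rule finite_field_vector_space_vec)
  show ?thesis using two_le_card_field by simp
qed

text \<open>The sequences supported on \<open>{..<a}\<close> form a space of \<open>q ^ a\<close>
  elements, hence of dimension \<open>a\<close>, to which the count of subspaces applies. For
  \<open>b > a\<close> both sides are 0.\<close>

lemma gauss_binom_eq:
  "real (gauss_binom TYPE('f::{field,finite}) a b) * q_falling (real CARD('f)) b b =
    q_falling (real CARD('f)) a b"
proof -
  interpret finite_field_vector_space "seq_scale :: 'f \<Rightarrow> _"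
    by (rule finite_field_vector_space_seq_scale)
  let ?W = "{v :: nat \<Rightarrow> 'f. \<forall>i\<ge>a. v i = 0}"
  have "?W = PiE_dflt {..<a} 0 (\<lambda>_. UNIV)" by (auto simp: PiE_dflt_def)
  hence W: "finite ?W" "card ?W = CARD('f) ^ a"
    by (simp_all add: finite_PiE_dflt card_PiE_dflt)
  have s: "subspace ?W" by (auto simp: subspace_def seq_scale_def)
  have "{V. V \<subseteq> ?W \<and> subspace V \<and> dim V = b} = {V. subspace V \<and> V \<subseteq> ?W \<and> dim V = b}" by blast
  thus ?thesis
    using card_subspaces_of_dim[OF s W(1), of b] dim_eqI[OF s W]
    by (simp add: gauss_binom_def q_falling_def)
qed

lemma gauss_binom_pos:
  assumes "b \<le> a"
  shows "gauss_binom TYPE('f::{field,finite}) a b > 0"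
proof -
  have "real (gauss_binom TYPE('f) a b) * q_falling (real CARD('f)) b b > 0"
    unfolding gauss_binom_eq by (intro q_falling_pos real_card_field_gt_1 assms)
  thus ?thesis by (simp add: zero_less_mult_iff)
qed

lemma dim_UNIV_vec: "vec.dim (UNIV :: ('f::{field,finite} ^ 'n) set) = CARD('n)"
proof -
  interpret finite_field_vector_space "(*s) :: 'f \<Rightarrow> 'f ^ 'n \<Rightarrow> 'f ^ 'n"
    by (rule finite_field_vector_space_vec)
  show ?thesis by (rule dim_eqI) auto
qed

lemma card_subspaces_vec:
  "card {U :: ('f::{field,finite} ^ 'n) set. vec.subspace U \<and> vec.dim U = d} =
    gauss_binom TYPE('f) CARD('n) d"
proof -
  interpret finite_field_vector_space "(*s) :: 'f \<Rightarrow> 'f ^ 'n \<Rightarrow> 'f ^ 'n"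
    by (rule finite_field_vector_space_vec)
  have "real (card {U :: ('f ^ 'n) set. vec.subspace U \<and> vec.dim U = d}) *
      q_falling (real CARD('f)) d d = real (gauss_binom TYPE('f) CARD('n) d) * q_falling (real CARD('f)) d d"
    using card_subspaces_of_dim[of UNIV d] dim_UNIV_vec[where ?'f = 'f and ?'n = 'n]
    unfolding gauss_binom_eq by (simp add: q_falling_def)
  moreover have "q_falling (real CARD('f)) d d \<noteq> 0"
    using q_falling_pos[OF real_card_field_gt_1[where ?'f = 'f], of d d] by simp
  ultimately show ?thesis by simp
qed

text \<open>\<open>card_subspaces_of_dim_Int_le\<close> after cancelling positive common factors.
  The right side is a summand of \<open>P_RD\<close> when \<open>R\<close> is the row space of an
  error.\<close>

lemma card_subspaces_vec_Int_le:
  fixes R :: "('f::{field,finite} ^ 'n) set"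
  assumes R: "vec.subspace R" and i: "i \<le> d"
  shows "real (card {U. vec.subspace U \<and> vec.dim U = d \<and> vec.dim (U \<inter> R) = i}) \<le>
    real (gauss_binom TYPE('f) (CARD('n) - vec.dim R) (d - i)) *
    real (gauss_binom TYPE('f) (vec.dim R) i) * real CARD('f) ^ ((vec.dim R - i) * (d - i))"
    (is "real (card ?S) \<le> _")
proof (cases "i \<le> vec.dim R")
  case False
  have "vec.dim (U \<inter> R) \<noteq> i" for U :: "('f ^ 'n) set"
    using vec.dim_subset[of "U \<inter> R" R] False by auto
  thus ?thesis by simp
next
  case ij: True
  interpret finite_field_vector_space "(*s) :: 'f \<Rightarrow> 'f ^ 'n \<Rightarrow> 'f ^ 'n"
    by (rule finite_field_vector_space_vec)
  let ?q = "real CARD('f)" and ?F = "q_falling (real CARD('f))" and ?j = "vec.dim R"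
  let ?g1 = "real (gauss_binom TYPE('f) ?j i)"
  let ?g2 = "real (gauss_binom TYPE('f) (CARD('n) - ?j) (d - i))"
  note q1 = real_card_field_gt_1[where ?'f = 'f]
  have jn: "?j \<le> CARD('n)"
    using vec.dim_subset[of R UNIV] by (simp add: dim_UNIV_vec del: vec.dim_UNIV)
  have "real (card ?S) * ((\<Prod>l<i. ?q ^ i - ?q ^ l) * (\<Prod>l<d - i. ?q ^ d - ?q ^ (i + l))) \<le>
      (\<Prod>l<i. ?q ^ ?j - ?q ^ l) * (\<Prod>l<d - i. ?q ^ CARD('n) - ?q ^ (?j + l))"
    using card_subspaces_of_dim_Int_le[of UNIV R i d] R i by (simp add: dim_UNIV_vec del: vec.dim_UNIV)
  also have "(\<Prod>l<d - i. ?q ^ d - ?q ^ (i + l)) = ?q ^ (i * (d - i)) * ?F (d - i) (d - i)"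
    using q_falling_shift[of ?q i "d - i" "d - i"] i by simp
  also have "(\<Prod>l<d - i. ?q ^ CARD('n) - ?q ^ (?j + l)) =
      ?q ^ (?j * (d - i)) * ?F (CARD('n) - ?j) (d - i)"
    using q_falling_shift[of ?q ?j "CARD('n) - ?j" "d - i"] jn by simp
  also have "?F (CARD('n) - ?j) (d - i) = ?g2 * ?F (d - i) (d - i)" by (simp add: gauss_binom_eq)
  also have "(\<Prod>l<i. ?q ^ ?j - ?q ^ l) = ?g1 * ?F i i"
    unfolding gauss_binom_eq by (simp add: q_falling_def)
  also have "(\<Prod>l<i. ?q ^ i - ?q ^ l) = ?F i i" by (simp add: q_falling_def)
  \<comment> \<open>The first power survives in the bound; the second cancels against the one
    extracted on the left side.\<close>
  also have "?q ^ (?j * (d - i)) = ?q ^ ((?j - i) * (d - i)) * ?q ^ (i * (d - i))"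
    using ij by (simp flip: power_add add: add_mult_distrib[symmetric])
  finally have "real (card ?S) * (?F i i * ?q ^ (i * (d - i)) * ?F (d - i) (d - i)) \<le>
      (?g2 * ?g1 * ?q ^ ((?j - i) * (d - i))) * (?F i i * ?q ^ (i * (d - i)) * ?F (d - i) (d - i))"
    by (simp add: mult_ac)
  moreover have "?F i i * ?q ^ (i * (d - i)) * ?F (d - i) (d - i) > 0"
    using q1 q_falling_pos[OF q1] by simp
  ultimately show ?thesis by (simp only: mult_le_cancel_right_pos)
qed

section \<open>Vectors over the extension field sorted by rank\<close>

lemma card_extension_field:
  assumes "field_embedding (h :: 'f::{field,finite} \<Rightarrow> 'e::{field,finite})"
  shows "CARD('e) = CARD('f) ^ ext_degree h"
proof -
  interpret finite_field_vector_space "ext_scale h"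
    by (rule finite_field_vector_space_ext_scale[OF assms])
  show ?thesis using card_subspace[of UNIV] by (simp add: ext_degree_def)
qed

lemma rk_eq:
  assumes "field_embedding h"
  shows "rk h a = vector_space.dim (ext_scale h) (range (($) a))"
proof -
  interpret vector_space "ext_scale h" by (rule vector_space_ext_scale[OF assms])
  show ?thesis by (simp add: rk_def)
qed

text \<open>A vector is a map from coordinates to the extension field and its rank is the dimension
  of the span of the image, so \<open>card_PiE_dim_image\<close> applies.\<close>

lemma card_rk:
  fixes h :: "'f::{field,finite} \<Rightarrow> 'e::{field,finite}"
  assumes h: "field_embedding h"
  shows "real (card {e :: 'e ^ 'n. rk h e = j}) * q_falling (real CARD('f)) j j =
    q_falling (real CARD('f)) (ext_degree h) j * q_falling (real CARD('f)) CARD('n) j"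
proof -
  interpret finite_field_vector_space "ext_scale h"
    by (rule finite_field_vector_space_ext_scale[OF h])
  have "bij_betw vec_nth {e :: 'e ^ 'n. rk h e = j} {f \<in> UNIV \<rightarrow>\<^sub>E UNIV. dim (range f) = j}"
    by (rule bij_betwI[of _ _ _ vec_lambda]) (auto simp: rk_eq[OF h] vec_lambda_inverse)
  hence "card {e :: 'e ^ 'n. rk h e = j} = card {f \<in> (UNIV :: 'n set) \<rightarrow>\<^sub>E (UNIV :: 'e set). dim (range f) = j}"
    by (rule bij_betw_same_card)
  thus ?thesis using card_PiE_dim_image[of UNIV "UNIV :: 'n set" j] by (simp add: ext_degree_def)
qed

section \<open>Row spaces over the small field\<close>

text \<open>For a subspace \<open>R\<close>, the span of its lifted vectors is the extension of
  scalars of \<open>R\<close>; a word lies in it exactly when its row space is contained in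
  \<open>R\<close>. Row spaces are handled through this criterion.\<close>

definition lift_vec :: "('f \<Rightarrow> 'e) \<Rightarrow> 'f ^ 'n \<Rightarrow> 'e ^ 'n" where
  "lift_vec h v = (\<chi> j. h (v $ j))"

lemma field_embedding_simps:
  assumes "field_embedding h"
  shows "h 1 = 1" "h (x + y) = h x + h y" "h (x * y) = h x * h y" "h 0 = 0"
proof -
  show "h 1 = 1" "h (x + y) = h x + h y" "h (x * y) = h x * h y"
    using assms by (auto simp: field_embedding_def)
  have "h 0 + h 0 = h 0 + 0"
    using assms unfolding field_embedding_def by (metis add_0 add.right_neutral)
  thus "h 0 = 0" unfolding add_left_cancel .
qed

lemma lift_vec_in_span:
  fixes h :: "'f::field \<Rightarrow> 'e::field" and v :: "'f ^ 'n"
  assumes h: "field_embedding h" and v: "v \<in> vec.span X"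
  shows "lift_vec h v \<in> vec.span (lift_vec h ` X)"
  using v
proof (induction rule: vec.span_induct_alt)
  case base
  have "lift_vec h 0 = (0 :: 'e ^ 'n)" using h by (simp add: lift_vec_def vec_eq_iff field_embedding_simps)
  thus ?case by (simp add: vec.span_zero)
next
  case (step c x y)
  have "lift_vec h (c *s x + y) = h c *s lift_vec h x + lift_vec h y"
    using h by (simp add: lift_vec_def vec_eq_iff field_embedding_simps)
  thus ?case using step by (simp add: vec.span_add vec.span_scale vec.span_base)
qed

lemma span_lift_vec_span:
  assumes "field_embedding h"
  shows "vec.span (lift_vec h ` vec.span X) = vec.span (lift_vec h ` X)"
proof
  show "vec.span (lift_vec h ` vec.span X) \<subseteq> vec.span (lift_vec h ` X)"
    using lift_vec_in_span[OF assms] by (intro vec.span_minimal) auto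
  show "vec.span (lift_vec h ` X) \<subseteq> vec.span (lift_vec h ` vec.span X)"
    by (intro vec.span_mono image_mono vec.span_superset)
qed

text \<open>Expanding \<open>e\<close> over the lifts of a basis of \<open>R\<close>, with
  coefficients \<open>u x\<close> in the extension field, makes every entry of \<open>e\<close> a
  combination of the at most \<open>dim R\<close> elements \<open>u x\<close> over the small
  field.\<close>

lemma rk_le_dim:
  fixes h :: "'f::{field,finite} \<Rightarrow> 'e::{field,finite}" and R :: "('f ^ 'n) set"
  assumes h: "field_embedding h" and e: "e \<in> vec.span (lift_vec h ` R)"
  shows "rk h e \<le> vec.dim R"
proof -
  interpret finite_field_vector_space "ext_scale h"
    by (rule finite_field_vector_space_ext_scale[OF h])
  obtain X where X: "X \<subseteq> R" "vec.independent X" "R \<subseteq> vec.span X" "card X = vec.dim R"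
    using vec.basis_exists by blast
  have "vec.span (lift_vec h ` R) \<subseteq> vec.span (lift_vec h ` vec.span X)"
    by (intro vec.span_mono image_mono X)
  hence "e \<in> vec.span (lift_vec h ` X)"
    using e unfolding span_lift_vec_span[OF h] by blast
  hence "\<exists>u. \<forall>j. e $ j = (\<Sum>x\<in>X. ext_scale h (x $ j) (u x))"
  proof (induction rule: vec.span_induct_alt)
    case base
    show ?case by (intro exI[of _ "\<lambda>_. 0"]) (simp add: ext_scale_def)
  next
    case (step c v y)
    then obtain x u where x: "x \<in> X" "v = lift_vec h x"
      and u: "\<And>j. y $ j = (\<Sum>x\<in>X. ext_scale h (x $ j) (u x))" by blast
    have "(c *s v + y) $ j = (\<Sum>z\<in>X. ext_scale h (z $ j) (u z + (if z = x then c else 0)))" for j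
    proof -
      have "(\<Sum>z\<in>X. h (z $ j) * (if z = x then c else 0)) = (\<Sum>z\<in>X. if z = x then h (x $ j) * c else 0)"
        by (intro sum.cong) auto
      also have "\<dots> = h (x $ j) * c" using x(1) by simp
      finally show ?thesis
        using x by (simp add: u ext_scale_def lift_vec_def distrib_left sum.distrib)
    qed
    thus ?case by (intro exI[of _ "\<lambda>z. u z + (if z = x then c else 0)"] allI)
  qed
  then obtain u where u: "\<And>j. e $ j = (\<Sum>x\<in>X. ext_scale h (x $ j) (u x))" by blast
  have "range (($) e) \<subseteq> span (u ` X)"
    using u by (auto intro!: span_sum span_scale intro: span_base)
  hence "dim (range (($) e)) \<le> card (u ` X)" by (intro dim_le_card) auto
  also have "\<dots> \<le> card X" by (simp add: card_image_le)
  finally show ?thesis using X by (simp add: rk_eq[OF h])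
qed

text \<open>
  Write \<open>e\<close> in a basis \<open>A\<close> of the span of its entries; the coefficient vectors span \<open>R\<close>.  Applying
  entrywise the functional dual to a basis element sends \<open>e\<close> to its coefficient vector and every
  \<open>lift_vec h ` S\<close>-combination into \<open>S\<close>, whence minimality.
\<close>

lemma minimal_row_space:
  fixes h :: "'f::{field,finite} \<Rightarrow> 'e::{field,finite}" and e :: "'e ^ 'n"
  assumes h: "field_embedding h"
  obtains R :: "('f ^ 'n) set"
  where "vec.subspace R" "vec.dim R = rk h e" "e \<in> vec.span (lift_vec h ` R)"
    "\<And>S. vec.subspace S \<Longrightarrow> e \<in> vec.span (lift_vec h ` S) \<Longrightarrow> R \<subseteq> S"
proof -
  interpret finite_field_vector_space "ext_scale h"
    by (rule finite_field_vector_space_ext_scale[OF h])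
  interpret pair: vector_space_pair "ext_scale h" "(*) :: 'f \<Rightarrow> 'f \<Rightarrow> 'f"
    by unfold_locales
  obtain A where A: "A \<subseteq> range (($) e)" "independent A" "range (($) e) \<subseteq> span A" "card A = dim (range (($) e))"
    using basis_exists by blast
  have finA: "finite A" by simp
  have "\<forall>j. \<exists>u. e $ j = (\<Sum>a\<in>A. ext_scale h (u a) a)"
    using A(3) unfolding span_finite[OF finA] by blast
  then obtain u where u: "\<And>j. e $ j = (\<Sum>a\<in>A. ext_scale h (u j a) a)" by metis
  define b where "b a = (\<chi> j. u j a)" for a
  define R where "R = vec.span (b ` A)"
  have e_eq: "e = (\<Sum>a\<in>A. a *s lift_vec h (b a))"
    by (simp add: vec_eq_iff u lift_vec_def b_def ext_scale_def mult.commute)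
  have e: "e \<in> vec.span (lift_vec h ` R)"
    unfolding R_def span_lift_vec_span[OF h]
    by (subst e_eq) (intro vec.span_sum vec.span_scale vec.span_base imageI)
  have minimal: "R \<subseteq> S" if S: "vec.subspace S" and eS: "e \<in> vec.span (lift_vec h ` S)" for S
    unfolding R_def
  proof (rule vec.span_minimal[OF _ S], clarify)
    fix a assume a: "a \<in> A"
    obtain \<phi> where lin: "Vector_Spaces.linear (ext_scale h) (*) \<phi>"
      and \<phi>: "\<And>a'. a' \<in> A \<Longrightarrow> \<phi> a' = (if a' = a then 1 else 0)"
      using pair.linear_independent_extend[OF A(2), of "\<lambda>a'. if a' = a then 1 else 0"] by blast
    interpret \<phi>: Vector_Spaces.linear "ext_scale h" "(*) :: 'f \<Rightarrow> 'f \<Rightarrow> 'f" \<phi> by fact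
    define \<Phi> :: "'e ^ 'n \<Rightarrow> 'f ^ 'n" where "\<Phi> v = (\<chi> j. \<phi> (v $ j))" for v
    have "\<Phi> v \<in> S" if "v \<in> vec.span (lift_vec h ` S)" for v
      using that
    proof (induction rule: vec.span_induct_alt)
      case base
      have "\<Phi> 0 = 0" by (simp add: \<Phi>_def vec_eq_iff \<phi>.zero)
      thus ?case using S by (simp add: vec.subspace_0)
    next
      case (step c x y)
      then obtain s where s: "s \<in> S" "x = lift_vec h s" by blast
      \<comment> \<open>\<open>\<phi>\<close> is linear over the small field, and entries of lifted
        vectors are scalars from there.\<close>
      have "\<phi> (c * h t) = \<phi> c * t" for t
        using \<phi>.scale[of t c] by (simp add: ext_scale_def mult.commute)
      hence "\<Phi> (c *s x + y) = \<phi> c *s s + \<Phi> y"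
        by (simp add: \<Phi>_def vec_eq_iff s lift_vec_def \<phi>.add)
      thus ?case using S s step by (simp add: vec.subspace_add vec.subspace_scale)
    qed
    moreover have "\<Phi> e = b a"
    proof -
      have "(\<Sum>a'\<in>A. u j a' * \<phi> a') = (\<Sum>a'\<in>A. if a' = a then u j a else 0)" for j
        using \<phi> by (intro sum.cong) auto
      thus ?thesis using a by (simp add: \<Phi>_def vec_eq_iff u b_def \<phi>.sum \<phi>.scale)
    qed
    ultimately show "b a \<in> S" using eS by metis
  qed
  \<comment> \<open>\<open>R\<close> has at most \<open>card A = rk h e\<close> generators; the
    reverse inequality is \<open>rk_le_dim\<close>.\<close>
  have "vec.dim R \<le> card (b ` A)" unfolding R_def vec.dim_span by (intro vec.dim_le_card) (auto simp: vec.span_superset)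
  also have "\<dots> \<le> card A" by (simp add: card_image_le)
  finally have "vec.dim R = rk h e"
    using rk_le_dim[OF h e] A by (simp add: rk_eq[OF h])
  thus ?thesis using that[of R] e minimal by (simp add: R_def)
qed

lemma erasure_word_in_span:
  "erasure_word h \<delta> a B \<in> vec.span (lift_vec h ` row_space \<delta> B)"
  unfolding erasure_word_def row_space_def lift_vec_def[symmetric]
  by (intro vec.span_sum vec.span_scale vec.span_base imageI) auto

text \<open>\<open>dim U + dim R - dim (U \<inter> R) = dim (U + R) \<le> dim (U + T) \<le> dim U +
  dim T\<close>, the middle step because \<open>R\<close> lies in \<open>U + T\<close>.\<close>

lemma dim_sum_le:
  fixes U T R :: "('f::field ^ 'n) set"
  assumes "vec.subspace U" "vec.subspace T" "vec.subspace R" "R \<subseteq> vec.span (U \<union> T)"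
  shows "vec.dim R \<le> vec.dim (U \<inter> R) + vec.dim T"
proof -
  have sums: "{x + y |x y. x \<in> A \<and> y \<in> B} = vec.span (A \<union> B)"
    if "vec.subspace A" "vec.subspace B" for A B :: "('f ^ 'n) set"
  proof -
    have "vec.span A = A" "vec.span B = B" using that by simp_all
    thus ?thesis by (simp only: vec.span_Un)
  qed
  have 1: "vec.dim (vec.span (U \<union> T)) + vec.dim (U \<inter> T) = vec.dim U + vec.dim T"
    using vec.dim_sums_Int[OF assms(1,2)] sums[OF assms(1,2)] by simp
  have 2: "vec.dim (vec.span (U \<union> R)) + vec.dim (U \<inter> R) = vec.dim U + vec.dim R"
    using vec.dim_sums_Int[OF assms(1,3)] sums[OF assms(1,3)] by simp
  have "vec.span (U \<union> R) \<subseteq> vec.span (U \<union> T)"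
    using assms by (intro vec.span_minimal) (auto intro: vec.span_base)
  hence "vec.dim (vec.span (U \<union> R)) \<le> vec.dim (vec.span (U \<union> T))" by (rule vec.dim_subset)
  thus ?thesis using 1 2 by linarith
qed

text \<open>If \<open>T\<close> is the row space of the residual, then \<open>e\<close> lies over
  \<open>U + T\<close>, so \<open>R \<subseteq> U + T\<close> by minimality. For \<open>R\<close>
  the row space of \<open>e\<close> this says that erasures on \<open>U\<close> lower the rank by at
  most \<open>dim (U \<inter> R)\<close>.\<close>

lemma rk_minus_erasure_word_ge:
  fixes h :: "'f::{field,finite} \<Rightarrow> 'e::{field,finite}" and e :: "'e ^ 'n"
  assumes h: "field_embedding h" and R: "vec.subspace R"
    and minimal: "\<And>S. vec.subspace S \<Longrightarrow> e \<in> vec.span (lift_vec h ` S) \<Longrightarrow> R \<subseteq> S"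
  shows "vec.dim R \<le> vec.dim (row_space \<delta> B \<inter> R) + rk h (e - erasure_word h \<delta> a B)"
proof -
  let ?U = "row_space \<delta> B" and ?e' = "e - erasure_word h \<delta> a B"
  have U: "vec.subspace ?U" by (simp add: row_space_def)
  obtain T where T: "vec.subspace T" "vec.dim T = rk h ?e'" "?e' \<in> vec.span (lift_vec h ` T)"
    using minimal_row_space[OF h, of ?e'] by metis
  have "?e' \<in> vec.span (lift_vec h ` vec.span (?U \<union> T))"
    using T(3) vec.span_mono[of "lift_vec h ` T" "lift_vec h ` vec.span (?U \<union> T)"]
      vec.span_superset[of "?U \<union> T"] by blast
  moreover have "erasure_word h \<delta> a B \<in> vec.span (lift_vec h ` vec.span (?U \<union> T))"
    using erasure_word_in_span[of h \<delta> a B] vec.span_superset[of "?U \<union> T"]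
      vec.span_mono[of "lift_vec h ` ?U" "lift_vec h ` vec.span (?U \<union> T)"] by blast
  ultimately have "?e' + erasure_word h \<delta> a B \<in> vec.span (lift_vec h ` vec.span (?U \<union> T))"
    by (rule vec.span_add)
  hence "R \<subseteq> vec.span (?U \<union> T)" using minimal[of "vec.span (?U \<union> T)"] by simp
  thus ?thesis using dim_sum_le[OF U T(1) R] T(2) by simp
qed

lemma card_Gab_le:
  fixes g :: "'e::{field,finite} ^ 'n"
  shows "card (Gab q k g) \<le> CARD('e) ^ k"
proof -
  interpret finite_field_vector_space "(*s) :: 'e \<Rightarrow> 'e ^ 'n \<Rightarrow> 'e ^ 'n"
    by (rule finite_field_vector_space_vec)
  let ?X = "(\<lambda>i. \<chi> j. g $ j ^ (q ^ i)) ` {..<k} :: ('e ^ 'n) set"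
  have "card (vec.span ?X) \<le> CARD('e) ^ card ?X" by (rule card_span_le) simp
  also have "\<dots> \<le> CARD('e) ^ k"
    using card_image_le[of "{..<k}"] two_le_card_field by (intro power_increasing) (auto intro: order_trans)
  finally show ?thesis by (simp add: Gab_def)
qed

section \<open>Waiting times in a random stream\<close>

text \<open>Generic form of \<open>rd_num_iterations\<close>, with \<open>G\<close> the set of
  successful guesses. A stream that never meets \<open>G\<close> gets \<open>\<infinity>\<close>,
  the infimum of the empty set.\<close>

definition first_hit :: "'a set \<Rightarrow> 'a stream \<Rightarrow> ennreal" where
  "first_hit G \<omega> = (INF t \<in> {t. \<omega> !! t \<in> G}. of_nat (Suc t))"

lemma first_hit_measurable [measurable]:
  "first_hit G \<in> borel_measurable (stream_space (measure_pmf p))"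
proof -
  \<comment> \<open>The index set depends on \<open>\<omega>\<close>; the default
    \<open>\<top>\<close> turns this into a countable infimum of measurable functions.\<close>
  have "first_hit G \<omega> = (INF t. if \<omega> !! t \<in> G then of_nat (Suc t) else \<top>)" for \<omega>
    unfolding first_hit_def
  proof (rule antisym)
    show "(INF t \<in> {t. \<omega> !! t \<in> G}. of_nat (Suc t)) \<le> (INF t. if \<omega> !! t \<in> G then of_nat (Suc t) else (\<top>::ennreal))"
      by (rule INF_greatest) (auto intro: INF_lower simp del: of_nat_Suc)
    show "(INF t. if \<omega> !! t \<in> G then of_nat (Suc t) else (\<top>::ennreal)) \<le> (INF t \<in> {t. \<omega> !! t \<in> G}. of_nat (Suc t))"
    proof (rule INF_greatest)
      fix t assume "t \<in> {t. \<omega> !! t \<in> G}"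
      thus "(INF t. if \<omega> !! t \<in> G then of_nat (Suc t) else (\<top>::ennreal)) \<le> of_nat (Suc t)"
        by (intro INF_lower2[of t]) (auto simp del: of_nat_Suc)
    qed
  qed
  moreover have "(\<lambda>\<omega>. (INF t. if \<omega> !! t \<in> G then of_nat (Suc t) else (\<top>::ennreal))) \<in>
      borel_measurable (stream_space (measure_pmf p))"
  proof (rule borel_measurable_INF)
    fix t :: nat
    have "(\<lambda>x. if x \<in> G then of_nat (Suc t) else \<top>) \<in> borel_measurable (measure_pmf p)" by simp
    thus "(\<lambda>\<omega>. if \<omega> !! t \<in> G then of_nat (Suc t) else (\<top>::ennreal)) \<in>
        borel_measurable (stream_space (measure_pmf p))"
      by (rule measurable_compose[OF measurable_snth])
  qed simp
  ultimately show ?thesis by presburger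
qed

text \<open>If the head misses \<open>G\<close>, the wait of the tail is added to the first draw. If
  it hits, the indicator removes that term even when it is infinite, as
  \<open>0 * \<infinity> = 0\<close> in \<open>ennreal\<close>.\<close>

lemma first_hit_SCons: "first_hit G (x ## \<omega>) \<ge> 1 + indicator (- G) x * first_hit G \<omega>"
  unfolding first_hit_def[of G "x ## \<omega>"]
proof (rule INF_greatest)
  fix t assume t: "t \<in> {t. (x ## \<omega>) !! t \<in> G}"
  show "1 + indicator (- G) x * first_hit G \<omega> \<le> of_nat (Suc t)"
  proof (cases "x \<in> G")
    case True
    thus ?thesis by (simp add: indicator_def)
  next
    case False
    then obtain u where u: "t = Suc u" "\<omega> !! u \<in> G" using t by (cases t) auto
    have "first_hit G \<omega> \<le> of_nat (Suc u)"
      unfolding first_hit_def using u by (intro INF_lower) simp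
    thus ?thesis using False u add_left_mono[of "first_hit G \<omega>" "of_nat (Suc u)" 1] by simp
  qed
qed

text \<open>Conditioning on the first draw gives \<open>1 + (1 - P) \<tau> \<le> \<tau>\<close> for
  the mean \<open>\<tau>\<close>, so \<open>P \<tau> \<ge> 1\<close> if \<open>\<tau>\<close> is
  finite. The tangent bound \<open>1 / P \<ge> 2 / s - P / s^2\<close> is stated with
  \<open>P / s^2\<close> moved across, which avoids subtraction in \<open>ennreal\<close> and
  includes \<open>P = 0\<close>.\<close>

lemma nn_integral_first_hit_ge:
  fixes p :: "'a pmf" and s :: real
  assumes s: "s > 0"
  shows "ennreal (2 / s) \<le> (\<integral>\<^sup>+\<omega>. first_hit G \<omega> \<partial>stream_space (measure_pmf p)) +
    ennreal (measure_pmf.prob p G / s\<^sup>2)"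
proof -
  let ?S = "stream_space (measure_pmf p)" and ?P = "measure_pmf.prob p G"
  define \<tau> where "\<tau> = (\<integral>\<^sup>+\<omega>. first_hit G \<omega> \<partial>?S)"
  interpret S: prob_space ?S by (rule prob_space.prob_space_stream_space[OF measure_pmf.prob_space_axioms])
  have "1 + ennreal (1 - ?P) * \<tau> = (\<integral>\<^sup>+x. 1 + indicator (- G) x * \<tau> \<partial>measure_pmf p)"
  proof -
    have "(\<integral>\<^sup>+x. 1 + indicator (- G) x * \<tau> \<partial>measure_pmf p) = 1 + emeasure (measure_pmf p) (- G) * \<tau>"
      by (subst nn_integral_add) (simp_all add: nn_integral_multc)
    thus ?thesis
      by (simp add: measure_pmf.emeasure_eq_measure measure_pmf.prob_compl[of G, simplified] Compl_eq_Diff_UNIV)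
  qed
  also have "\<dots> = (\<integral>\<^sup>+x. \<integral>\<^sup>+\<omega>. 1 + indicator (- G) x * first_hit G \<omega> \<partial>?S \<partial>measure_pmf p)"
    by (simp add: nn_integral_add nn_integral_cmult \<tau>_def S.emeasure_space_1)
  also have "\<dots> \<le> (\<integral>\<^sup>+x. \<integral>\<^sup>+\<omega>. first_hit G (x ## \<omega>) \<partial>?S \<partial>measure_pmf p)"
    by (intro nn_integral_mono first_hit_SCons)
  also have "\<dots> = \<tau>"
    unfolding \<tau>_def by (rule prob_space.nn_integral_stream_space[OF measure_pmf.prob_space_axioms, symmetric]) (rule first_hit_measurable)
  finally have le: "1 + ennreal (1 - ?P) * \<tau> \<le> \<tau>" .
  show ?thesis
  proof (cases \<tau>)
    case top
    thus ?thesis by (simp add: \<tau>_def[symmetric])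
  next
    case (real t)
    have P: "0 \<le> ?P" "?P \<le> 1" by simp_all
    have "ennreal (1 + (1 - ?P) * t) \<le> ennreal t"
      using le real P by (simp add: ennreal_mult flip: ennreal_1)
    hence "1 \<le> ?P * t" using real by (simp add: ennreal_le_iff algebra_simps)
    hence "1 \<le> t * ?P" "t > 0" using real P by (auto simp: mult.commute intro: ccontr)
    \<comment> \<open>By \<open>(t s - 1)^2 \<ge> 0\<close> and \<open>t P \<ge> 1\<close>:
      \<open>2 s t \<le> t^2 s^2 + 1 \<le> t^2 s^2 + t P\<close>.\<close>
    hence "2 * s * t \<le> t * (t * s\<^sup>2 + ?P)"
      using zero_le_power2[of "t * s - 1"] by (simp add: power2_eq_square algebra_simps)
    hence "2 * s \<le> t * s\<^sup>2 + ?P" using \<open>t > 0\<close> by (simp add: mult.commute)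
    hence "2 / s \<le> t + ?P / s\<^sup>2" using s by (simp add: field_simps power2_eq_square)
    hence "ennreal (2 / s) \<le> ennreal t + ennreal (?P / s\<^sup>2)"
      using real P by (simp flip: ennreal_plus)
    thus ?thesis using real by (simp add: \<tau>_def)
  qed
qed

text \<open>
  Jensen's inequality for \<open>1/x\<close>, by integrating its tangent line at \<open>s\<close>.
\<close>

lemma nn_integral_first_hit_pair_ge:
  fixes p :: "'a pmf" and G :: "'r::finite \<Rightarrow> 'a set" and s :: real
  assumes s: "s > 0" and le: "(\<Sum>r\<in>UNIV. measure_pmf.prob p (G r)) \<le> s * CARD('r)"
  shows "ennreal (1 / s) \<le> (\<integral>\<^sup>+ (r, \<omega>). first_hit (G r) \<omega>
    \<partial>(measure_pmf (pmf_of_set UNIV) \<Otimes>\<^sub>M stream_space (measure_pmf p)))"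
proof -
  let ?S = "stream_space (measure_pmf p)" and ?U = "measure_pmf (pmf_of_set (UNIV :: 'r set))"
  let ?P = "\<lambda>r. measure_pmf.prob p (G r)"
  interpret S: prob_space ?S by (rule prob_space.prob_space_stream_space[OF measure_pmf.prob_space_axioms])
  define I where "I = (\<integral>\<^sup>+r. \<integral>\<^sup>+\<omega>. first_hit (G r) \<omega> \<partial>?S \<partial>?U)"
  have meas: "(\<lambda>(r, \<omega>). first_hit (G r) \<omega>) \<in> borel_measurable (?U \<Otimes>\<^sub>M ?S)"
  proof -
    have "(\<lambda>(r, \<omega>). first_hit (G r) \<omega>) \<in> borel_measurable (count_space UNIV \<Otimes>\<^sub>M ?S)"
      by (rule measurable_pair_measure_countable1) (auto intro: countable_finite first_hit_measurable)
    thus ?thesis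
      by (simp cong: measurable_cong_sets sets_pair_measure_cong add: sets_measure_pmf_count_space)
  qed
  have I: "(\<integral>\<^sup>+ (r, \<omega>). first_hit (G r) \<omega> \<partial>(?U \<Otimes>\<^sub>M ?S)) = I"
    unfolding I_def using S.nn_integral_fst[OF meas] by simp
  have "ennreal (2 / s) = (\<integral>\<^sup>+r. ennreal (2 / s) \<partial>?U)" by simp
  also have "\<dots> \<le> (\<integral>\<^sup>+r. (\<integral>\<^sup>+\<omega>. first_hit (G r) \<omega> \<partial>?S) + ennreal (?P r / s\<^sup>2) \<partial>?U)"
    by (intro nn_integral_mono nn_integral_first_hit_ge s)
  also have "\<dots> = I + (\<integral>\<^sup>+r. ennreal (?P r / s\<^sup>2) \<partial>?U)"
    unfolding I_def by (rule nn_integral_add) simp_all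
  also have "(\<integral>\<^sup>+r. ennreal (?P r / s\<^sup>2) \<partial>?U) = ennreal ((\<Sum>r\<in>UNIV. ?P r / s\<^sup>2) / CARD('r))"
    by (subst nn_integral_pmf_of_set)
      (simp_all add: sum_ennreal divide_ennreal sum_nonneg ennreal_of_nat_eq_real_of_nat)
  also have "\<dots> \<le> ennreal (1 / s)"
  proof (rule ennreal_leI)
    have "(\<Sum>r\<in>UNIV. ?P r / s\<^sup>2) / CARD('r) = (\<Sum>r\<in>UNIV. ?P r) / (s\<^sup>2 * CARD('r))"
      by (simp add: sum_divide_distrib[symmetric])
    also have "\<dots> \<le> s * CARD('r) / (s\<^sup>2 * CARD('r))"
      using le s by (intro divide_right_mono) auto
    also have "\<dots> = 1 / s" using s by (simp add: power2_eq_square)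
    finally show "(\<Sum>r\<in>UNIV. ?P r / s\<^sup>2) / CARD('r) \<le> 1 / s" .
  qed
  finally have *: "ennreal (2 / s) \<le> I + ennreal (1 / s)" by (simp add: add_left_mono)
  \<comment> \<open>The mean of \<open>?P r\<close> is at most \<open>s\<close>, so the linear term
    costs at most \<open>1 / s\<close> out of \<open>2 / s\<close>; this finite amount is
    cancelled.\<close>
  have "ennreal (1 / s) \<le> I"
  proof (cases I)
    case (real t)
    have "ennreal (2 / s) \<le> ennreal (t + 1 / s)" using * real s by (simp add: ennreal_plus)
    hence "2 / s \<le> t + 1 / s" by (rule ennreal_le_iff[THEN iffD1, rotated]) (use real s in simp)
    thus ?thesis using real by (simp add: ennreal_leI)
  qed simp
  thus ?thesis unfolding I .
qed

section \<open>Success probability of one iteration\<close>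

text \<open>The guesses \<open>U\<close> are sorted by \<open>i = dim (U \<inter> R)\<close>, with
  \<open>R\<close> the row space of \<open>e\<close>. The ceiling in \<open>P_RD\<close> is the
  least \<open>i\<close> with \<open>2 (j - i) + \<delta> \<le> n - k\<close>. In the other case
  \<open>P_RD = 1\<close> and all guesses are counted.\<close>

lemma card_decodable_spaces_le:
  fixes h :: "'f::{field,finite} \<Rightarrow> 'e::{field,finite}" and e :: "'e ^ 'n"
    and \<B> :: "('f ^ 'n) set \<Rightarrow> nat \<Rightarrow> 'f ^ 'n"
  assumes h: "field_embedding h" and k: "k \<le> CARD('n)" and \<delta>: "\<delta> \<le> CARD('n)"
    and \<B>: "\<And>U. vec.subspace U \<Longrightarrow> row_space (vec.dim U) (\<B> U) = U"
  shows "real (card {U. vec.subspace U \<and> vec.dim U = \<delta> \<and>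
      (\<exists>a. 2 * rk h (e - erasure_word h \<delta> a (\<B> U)) + \<delta> \<le> CARD('n) - k)}) \<le>
    real (gauss_binom TYPE('f) CARD('n) \<delta>) * P_RD TYPE('f) CARD('n) k \<delta> (rk h e)"
    (is "real (card ?S) \<le> ?g * _")
proof (cases "2 * rk h e + \<delta> > CARD('n) - k")
  case False
  have "card ?S \<le> card {U :: ('f ^ 'n) set. vec.subspace U \<and> vec.dim U = \<delta>}"
    by (rule card_mono) auto
  thus ?thesis using False by (simp add: P_RD_def card_subspaces_vec)
next
  case True
  let ?n = "CARD('n)" and ?j = "rk h e"
  let ?lo = "nat \<lceil>real ?j - (real ?n - real k) / 2 + real \<delta> / 2\<rceil>"
  obtain R :: "('f ^ 'n) set" where R: "vec.subspace R" "vec.dim R = ?j"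
    and min: "\<And>S. vec.subspace S \<Longrightarrow> e \<in> vec.span (lift_vec h ` S) \<Longrightarrow> R \<subseteq> S"
    using minimal_row_space[OF h, of e] by metis
  let ?T = "\<lambda>i. {U. vec.subspace U \<and> vec.dim U = \<delta> \<and> vec.dim (U \<inter> R) = i}"
  have sub: "?S \<subseteq> (\<Union>i\<in>{?lo..min \<delta> ?j}. ?T i)"
  proof
    fix U assume "U \<in> ?S"
    then obtain a where U: "vec.subspace U" "vec.dim U = \<delta>"
      and a: "2 * rk h (e - erasure_word h \<delta> a (\<B> U)) + \<delta> \<le> ?n - k" by blast
    let ?i = "vec.dim (U \<inter> R)"
    have "?j \<le> ?i + rk h (e - erasure_word h \<delta> a (\<B> U))"
      using rk_minus_erasure_word_ge[OF h R(1) min, where \<delta> = \<delta> and B = "\<B> U" and a = a] \<B>[OF U(1)] U(2) R(2) by simp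
    hence "2 * ?j + \<delta> + k \<le> ?n + 2 * ?i" using a k by linarith
    hence "real (2 * ?j + \<delta> + k) \<le> real (?n + 2 * ?i)" by (rule of_nat_mono)
    hence "real ?j - (real ?n - real k) / 2 + real \<delta> / 2 \<le> real ?i" by (simp add: field_simps)
    hence "?lo \<le> ?i" by (simp add: nat_le_iff ceiling_le_iff)
    moreover have "?i \<le> \<delta>" "?i \<le> ?j"
      using vec.dim_subset[of "U \<inter> R" U] vec.dim_subset[of "U \<inter> R" R] U R by auto
    ultimately show "U \<in> (\<Union>i\<in>{?lo..min \<delta> ?j}. ?T i)" using U by auto
  qed
  have "card ?S \<le> card (\<Union>i\<in>{?lo..min \<delta> ?j}. ?T i)"
    by (rule card_mono[OF _ sub]) simp
  also have "\<dots> \<le> (\<Sum>i\<in>{?lo..min \<delta> ?j}. card (?T i))" by (rule card_UN_le) simp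
  finally have "real (card ?S) \<le> (\<Sum>i\<in>{?lo..min \<delta> ?j}. real (card (?T i)))"
    by (simp flip: of_nat_sum)
  also have "\<dots> \<le> (\<Sum>i\<in>{?lo..min \<delta> ?j}. real (gauss_binom TYPE('f) (?n - ?j) (\<delta> - i)) *
      real (gauss_binom TYPE('f) ?j i) * real CARD('f) ^ ((?j - i) * (\<delta> - i)))"
    using card_subspaces_vec_Int_le[OF R(1)] R(2) by (intro sum_mono) simp
  also have "\<dots> = ?g * P_RD TYPE('f) ?n k \<delta> ?j"
  proof -
    have "?g \<noteq> 0" using gauss_binom_pos[OF \<delta>] by simp
    thus ?thesis using True by (simp add: P_RD_def)
  qed
  finally show ?thesis .
qed

lemma rd_iteration_returns:
  assumes "rd_iteration h k g \<delta> w B r \<noteq> None"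
  obtains c where "rk h (r - c) \<le> w" "ee_decodable h k g \<delta> B r c"
  using assms someI_ex[of "ee_decodable h k g \<delta> B r"]
  by (auto simp: rd_iteration_def ee_decoder_def split: if_splits)

text \<open>The product is the rank count of \<open>card_rk\<close>. Hence, for a code of
  \<open>q^(m k)\<close> words, \<open>A_bar\<close> is the expected number of codewords at rank
  distance \<open>j\<close> from a uniform word.\<close>

lemma A_bar_eq:
  fixes h :: "'f::{field,finite} \<Rightarrow> 'e::{field,finite}"
  assumes h: "field_embedding h"
  shows "A_bar CARD('f) (ext_degree h) CARD('n) k j =
    real CARD('f) powi (int (ext_degree h) * (int k - int CARD('n))) * real (card {e :: 'e ^ 'n. rk h e = j})"
proof -
  let ?q = "real CARD('f)"
  have "q_falling ?q j j \<noteq> 0"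
    using q_falling_pos[OF real_card_field_gt_1[where ?'f = 'f], of j j] by simp
  hence "real (card {e :: 'e ^ 'n. rk h e = j}) =
      q_falling ?q (ext_degree h) j * q_falling ?q CARD('n) j / q_falling ?q j j"
    using card_rk[OF h, where ?'n = 'n, of j] by (simp add: nonzero_eq_divide_eq)
  thus ?thesis by (simp add: A_bar_def q_falling_def prod_dividef prod.distrib)
qed

lemma sum_success_probability_le:
  fixes h :: "'f::{field,finite} \<Rightarrow> 'e::{field,finite}" and g :: "'e ^ 'n"
    and \<B> :: "('f ^ 'n) set \<Rightarrow> nat \<Rightarrow> 'f ^ 'n"
  assumes h: "field_embedding h" and k: "k \<le> CARD('n)" and \<delta>: "\<delta> \<le> CARD('n)"
    and \<B>: "\<And>U. vec.subspace U \<Longrightarrow> row_space (vec.dim U) (\<B> U) = U"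
  shows "(\<Sum>r\<in>UNIV. measure_pmf.prob (pmf_of_set {U. vec.subspace U \<and> vec.dim U = \<delta>})
      {U. rd_iteration h k g \<delta> w (\<B> U) r \<noteq> None}) \<le>
    (\<Sum>j=0..w. A_bar CARD('f) (ext_degree h) CARD('n) k j * P_RD TYPE('f) CARD('n) k \<delta> j) *
      real CARD('e ^ 'n)"
proof -
  let ?n = "CARD('n)" and ?q = "real CARD('f)" and ?m = "ext_degree h"
  let ?S = "{U :: ('f ^ 'n) set. vec.subspace U \<and> vec.dim U = \<delta>}"
  let ?C = "Gab CARD('f) k g"
  define gb where "gb = real (gauss_binom TYPE('f) ?n \<delta>)"
  define D where "D e = {U. vec.subspace U \<and> vec.dim U = \<delta> \<and>
      (\<exists>a. 2 * rk h (e - erasure_word h \<delta> a (\<B> U)) + \<delta> \<le> ?n - k)}" for e :: "'e ^ 'n"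
  define N where "N j = real (card {e :: 'e ^ 'n. rk h e = j})" for j
  have gb: "gb > 0" using gauss_binom_pos[OF \<delta>] by (simp add: gb_def)
  have S: "real (card ?S) = gb" by (simp add: gb_def card_subspaces_vec)
  hence S: "?S \<noteq> {}" "finite ?S" "real (card ?S) = gb" using gb by (auto simp del: Collect_empty_eq)
  have "(\<Sum>r\<in>UNIV. real (card (?S \<inter> {U. rd_iteration h k g \<delta> w (\<B> U) r \<noteq> None}))) \<le>
      (\<Sum>r\<in>UNIV. \<Sum>c\<in>?C. if rk h (r - c) \<le> w then real (card (D (r - c))) else 0)"
  proof (rule sum_mono)
    fix r :: "'e ^ 'n"
    \<comment> \<open>A successful guess decodes some codeword \<open>c\<close> within distance
      \<open>w\<close>, so it belongs to \<open>D (r - c)\<close>.\<close>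
    have "?S \<inter> {U. rd_iteration h k g \<delta> w (\<B> U) r \<noteq> None} \<subseteq>
        (\<Union>c\<in>{c \<in> ?C. rk h (r - c) \<le> w}. D (r - c))"
    proof
      fix U assume U: "U \<in> ?S \<inter> {U. rd_iteration h k g \<delta> w (\<B> U) r \<noteq> None}"
      then obtain c where "rk h (r - c) \<le> w" "ee_decodable h k g \<delta> (\<B> U) r c"
        using rd_iteration_returns by blast
      thus "U \<in> (\<Union>c\<in>{c \<in> ?C. rk h (r - c) \<le> w}. D (r - c))"
        using U by (auto simp: ee_decodable_def D_def)
    qed
    hence "card (?S \<inter> {U. rd_iteration h k g \<delta> w (\<B> U) r \<noteq> None}) \<le>
        card (\<Union>c\<in>{c \<in> ?C. rk h (r - c) \<le> w}. D (r - c))"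
      by (intro card_mono) auto
    also have "\<dots> \<le> (\<Sum>c\<in>{c \<in> ?C. rk h (r - c) \<le> w}. card (D (r - c)))"
      by (rule card_UN_le) simp
    also have "\<dots> = (\<Sum>c\<in>?C. if rk h (r - c) \<le> w then card (D (r - c)) else 0)"
      by (rule sum.inter_filter) simp
    finally have "real (card (?S \<inter> {U. rd_iteration h k g \<delta> w (\<B> U) r \<noteq> None})) \<le>
        real (\<Sum>c\<in>?C. if rk h (r - c) \<le> w then card (D (r - c)) else 0)"
      by (rule of_nat_mono)
    also have "\<dots> = (\<Sum>c\<in>?C. if rk h (r - c) \<le> w then real (card (D (r - c))) else 0)"
      unfolding of_nat_sum by (intro sum.cong) auto
    finally show "real (card (?S \<inter> {U. rd_iteration h k g \<delta> w (\<B> U) r \<noteq> None})) \<le>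
        (\<Sum>c\<in>?C. if rk h (r - c) \<le> w then real (card (D (r - c))) else 0)" .
  qed
  also have "\<dots> = (\<Sum>c\<in>?C. \<Sum>r\<in>UNIV. if rk h (r - c) \<le> w then real (card (D (r - c))) else 0)"
    by (rule sum.swap)
  \<comment> \<open>For fixed \<open>c\<close> the map \<open>r \<mapsto> r - c\<close> permutes the
    space, so the inner sum is the same for every codeword.\<close>
  also have "\<dots> = (\<Sum>c\<in>?C. \<Sum>e\<in>UNIV. if rk h e \<le> w then real (card (D e)) else 0)"
    by (intro sum.cong refl sum.reindex_bij_betw[of "\<lambda>r. r - _", where T = UNIV]) (simp add: bij_diff_right)
  also have "\<dots> = real (card ?C) * (\<Sum>e\<in>UNIV. if rk h e \<le> w then real (card (D e)) else 0)" by simp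
  also have "\<dots> \<le> real CARD('e) ^ k * (\<Sum>j=0..w. N j * (gb * P_RD TYPE('f) ?n k \<delta> j))"
  proof (rule mult_mono)
    show "real (card ?C) \<le> real CARD('e) ^ k"
      using card_Gab_le[of "CARD('f)" k g] by (simp flip: of_nat_power)
    have "(\<Sum>e\<in>UNIV. if rk h e \<le> w then real (card (D e)) else 0) =
        (\<Sum>e | rk h e \<le> w. real (card (D e)))"
      by (simp add: sum.inter_filter[symmetric])
    also have "\<dots> = (\<Sum>j\<in>{0..w}. \<Sum>e | e \<in> {e. rk h e \<le> w} \<and> rk h e = j. real (card (D e)))"
      by (rule sum.group[symmetric]) auto
    also have "\<dots> \<le> (\<Sum>j\<in>{0..w}. \<Sum>e | e \<in> {e :: 'e ^ 'n. rk h e \<le> w} \<and> rk h e = j. gb * P_RD TYPE('f) ?n k \<delta> j)"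
    proof (intro sum_mono)
      fix j and e :: "'e ^ 'n" assume "e \<in> {e. e \<in> {e. rk h e \<le> w} \<and> rk h e = j}"
      thus "real (card (D e)) \<le> gb * P_RD TYPE('f) ?n k \<delta> j"
        using card_decodable_spaces_le[OF h k \<delta> \<B>, of e] by (auto simp: D_def gb_def)
    qed
    also have "\<dots> = (\<Sum>j\<in>{0..w}. N j * (gb * P_RD TYPE('f) ?n k \<delta> j))"
      unfolding N_def sum_constant by (intro sum.cong arg_cong2[where f = "(*)"] arg_cong[where f = card] arg_cong[where f = real]) auto
    finally show "(\<Sum>e\<in>UNIV. if rk h e \<le> w then real (card (D e)) else 0) \<le>
        (\<Sum>j=0..w. N j * (gb * P_RD TYPE('f) ?n k \<delta> j))" .
  qed (auto intro!: sum_nonneg)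
  also have "\<dots> = gb * ((\<Sum>j=0..w. A_bar CARD('f) ?m ?n k j * P_RD TYPE('f) ?n k \<delta> j) * real CARD('e ^ 'n))"
  proof -
    have "real CARD('e ^ 'n) = ?q powi int (?m * ?n)" and e: "real CARD('e) ^ k = ?q powi int (?m * k)"
      unfolding power_int_of_nat using card_extension_field[OF h] by (simp_all add: power_mult)
    \<comment> \<open>Multiplying \<open>q^(m (k - n))\<close> by the number \<open>q^(m n)\<close>
      of words leaves \<open>q^(m k)\<close>, the bound for the code size; \<open>powi\<close>
      allows the negative exponent.\<close>
    hence "?q powi (int ?m * (int k - int ?n)) * real CARD('e ^ 'n) =
        ?q powi (int ?m * (int k - int ?n) + int (?m * ?n))"
      using power_int_add[of ?q "int ?m * (int k - int ?n)" "int (?m * ?n)"] by simp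
    also have "int ?m * (int k - int ?n) + int (?m * ?n) = int (?m * k)" by (simp add: algebra_simps)
    finally have "?q powi (int ?m * (int k - int ?n)) * real CARD('e ^ 'n) = real CARD('e) ^ k"
      unfolding e .
    thus ?thesis
      unfolding A_bar_eq[OF h, where ?'n = 'n] N_def[symmetric]
      by (simp add: sum_distrib_left sum_distrib_right mult_ac flip: \<open>_ = real CARD('e) ^ k\<close>)
  qed
  finally have *: "(\<Sum>r\<in>UNIV. real (card (?S \<inter> {U. rd_iteration h k g \<delta> w (\<B> U) r \<noteq> None}))) \<le> \<dots>" .
  have "(\<Sum>r\<in>UNIV. measure_pmf.prob (pmf_of_set ?S) {U. rd_iteration h k g \<delta> w (\<B> U) r \<noteq> None}) =
      (\<Sum>r\<in>UNIV. real (card (?S \<inter> {U. rd_iteration h k g \<delta> w (\<B> U) r \<noteq> None}))) / gb"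
    using S by (simp add: measure_pmf_of_set sum_divide_distrib)
  thus ?thesis using * gb by (simp add: divide_le_eq mult.commute)
qed

section \<open>Estimates in powers of q\<close>

text \<open>\<open>q_falling q b b\<close> is \<open>q^(b^2)\<close> times the product of the
  \<open>1 - q^(-i)\<close> for \<open>1 \<le> i \<le> b\<close>. The lower bound 1/4 for this
  product is not inductive by itself; the extra term \<open>(1 / 2) ^ (b + 2)\<close> pays for the
  next factor.\<close>

lemma q_falling_diag_ge_aux:
  assumes q: "q \<ge> (2::real)"
  shows "q ^ (Suc b * Suc b) * (1 / 4 + (1 / 2) ^ (b + 2)) \<le> q_falling q (Suc b) (Suc b)"
proof (induction b)
  case 0
  have "q_falling q (Suc 0) (Suc 0) = q - 1" by (simp add: q_falling_def)
  thus ?case using q by simp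
next
  case (Suc b)
  define x :: real where "x = (1 / 2) ^ b"
  have x: "0 \<le> x" "x \<le> 1" by (auto simp: x_def power_le_one)
  have "(1 / 2) ^ Suc (Suc b) = inverse ((2::real) ^ Suc (Suc b))" by (simp add: power_one_over inverse_eq_divide)
  moreover have "(2::real) ^ Suc (Suc b) \<le> q ^ Suc (Suc b)" using q by (intro power_mono) auto
  ultimately have "1 \<le> q ^ Suc (Suc b) * (1 / 2) ^ Suc (Suc b)" by (simp add: field_simps)
  hence 1: "q ^ Suc (Suc b) * (1 - x / 4) \<le> q ^ Suc (Suc b) - 1" by (simp add: x_def algebra_simps)
  \<comment> \<open>The new factor is at least \<open>1 - x / 4\<close>; after it the bound needed
    for the next index is \<open>1 / 4 + x / 8\<close>.\<close>
  have "(1 / 4 + x / 4) * (1 - x / 4) - (1 / 4 + x / 8) = x * (1 - x) / 16"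
    by (simp add: field_simps)
  moreover have "0 \<le> x * (1 - x) / 16" using x by simp
  ultimately have 2: "1 / 4 + x / 8 \<le> (1 / 4 + x / 4) * (1 - x / 4)" by linarith
  have e: "q ^ (Suc (Suc b) * Suc (Suc b)) = q ^ Suc (Suc b) * q ^ Suc b * q ^ (Suc b * Suc b)"
    by (simp flip: power_add)
  have "q ^ (Suc (Suc b) * Suc (Suc b)) * (1 / 4 + x / 8) \<le>
      q ^ (Suc (Suc b) * Suc (Suc b)) * ((1 / 4 + x / 4) * (1 - x / 4))"
    using 2 q by (intro mult_left_mono) auto
  also have "\<dots> = (q ^ Suc (Suc b) * (1 - x / 4)) * q ^ Suc b * (q ^ (Suc b * Suc b) * (1 / 4 + x / 4))"
    unfolding e by (simp only: mult_ac)
  also have "\<dots> \<le> (q ^ Suc (Suc b) - 1) * q ^ Suc b * q_falling q (Suc b) (Suc b)"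
    using Suc 1 q x one_le_power[of q "Suc (Suc b)"] by (intro mult_mono) (auto simp: x_def)
  finally show ?case by (simp add: q_falling_Suc_Suc[of q "Suc b"] x_def)
qed

lemma q_falling_diag_ge:
  assumes q: "q \<ge> (2::real)"
  shows "q ^ (b * b) \<le> 4 * q_falling q b b"
proof (cases b)
  case 0
  thus ?thesis by (simp add: q_falling_0)
next
  case (Suc c)
  have "q ^ (b * b) * (1 / 4) \<le> q ^ (b * b) * (1 / 4 + (1 / 2) ^ (c + 2))"
    using q by (intro mult_left_mono) auto
  also have "\<dots> \<le> q_falling q b b" using q_falling_diag_ge_aux[OF q, of c] Suc by simp
  finally show ?thesis by simp
qed

section \<open>Bounds for Gaussian binomials and for \<open>A_bar\<close>\<close>

lemma q_falling_le:
  assumes q: "q \<ge> (1::real)" and b: "b \<le> a"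
  shows "q_falling q a b \<le> q ^ (a * b)"
proof -
  have "q_falling q a b \<le> (\<Prod>l<b. q ^ a)"
    unfolding q_falling_def
  proof (rule prod_mono)
    fix l assume "l \<in> {..<b}"
    hence "q ^ l \<le> q ^ a" using b q by (intro power_increasing) auto
    thus "0 \<le> q ^ a - q ^ l \<and> q ^ a - q ^ l \<le> q ^ a" using q by simp
  qed
  thus ?thesis by (simp add: power_mult)
qed

lemma two_le_real_card_field: "2 \<le> real CARD('f::{field,finite})"
  using real_card_field_gt_1[where ?'f = 'f] by simp

text \<open>Divide \<open>q_falling q a b \<le> q^(a b)\<close> by
  \<open>q_falling q b b \<ge> q^(b^2) / 4\<close>. The real exponent may be negative, which covers
  \<open>b > a\<close>, where the left side is 0.\<close>

lemma gauss_binom_le: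
  fixes q :: real
  defines "q \<equiv> real CARD('f::{field,finite})"
  shows "real (gauss_binom TYPE('f) a b) \<le> 4 * q powr (real b * (real a - real b))"
proof (cases "b \<le> a")
  case b: True
  have q: "q \<ge> 2" unfolding q_def by (rule two_le_real_card_field)
  have F: "q_falling q b b > 0" using q by (intro q_falling_pos) auto
  have p: "q ^ (a * b) = q powr (real b * (real a - real b)) * q ^ (b * b)"
    using q by (simp add: powr_realpow[symmetric] powr_add[symmetric] algebra_simps)
  have "real (gauss_binom TYPE('f) a b) * q_falling q b b = q_falling q a b"
    unfolding q_def by (rule gauss_binom_eq)
  also have "\<dots> \<le> q ^ (a * b)" using q by (intro q_falling_le b) auto
  also have "\<dots> \<le> q powr (real b * (real a - real b)) * (4 * q_falling q b b)"
    unfolding p using q_falling_diag_ge[OF q, of b] by (intro mult_left_mono) auto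
  finally show ?thesis using F by simp
next
  case False
  have "q_falling q a b = 0"
    using False unfolding q_falling_def by (intro prod_zero) auto
  moreover have "q_falling q b b > 0"
    unfolding q_def by (intro q_falling_pos real_card_field_gt_1) auto
  ultimately have "real (gauss_binom TYPE('f) a b) = 0"
    using gauss_binom_eq[where ?'f = 'f, of a b] by (simp add: q_def)
  thus ?thesis by simp
qed

text \<open>Factor by factor, \<open>q^(a-b) (q^b - q^l) \<le> q^a - q^l\<close>.\<close>

lemma gauss_binom_ge:
  fixes q :: real
  defines "q \<equiv> real CARD('f::{field,finite})"
  assumes b: "b \<le> a"
  shows "q powr (real b * (real a - real b)) \<le> real (gauss_binom TYPE('f) a b)"
proof -
  have q: "q > 1" unfolding q_def by (rule real_card_field_gt_1)
  have F: "q_falling q b b > 0" using q by (intro q_falling_pos) auto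
  have "q ^ ((a - b) * b) * q_falling q b b = (\<Prod>l<b. q ^ (a - b) * (q ^ b - q ^ l))"
    by (simp add: q_falling_def prod.distrib power_mult)
  also have "\<dots> \<le> q_falling q a b"
    unfolding q_falling_def
  proof (rule prod_mono)
    fix l assume l: "l \<in> {..<b}"
    have "q ^ l \<le> q ^ b" using l q by (intro power_increasing) auto
    moreover have "q ^ (a - b) * q ^ b = q ^ a" using b by (simp flip: power_add)
    moreover have "q ^ l * 1 \<le> q ^ l * q ^ (a - b)" using q by (intro mult_left_mono) auto
    ultimately have "0 \<le> q ^ (a - b) * (q ^ b - q ^ l)" "q ^ (a - b) * (q ^ b - q ^ l) \<le> q ^ a - q ^ l"
      using q by (simp, simp add: right_diff_distrib mult.commute)
    thus "0 \<le> q ^ (a - b) * (q ^ b - q ^ l) \<and> q ^ (a - b) * (q ^ b - q ^ l) \<le> q ^ a - q ^ l" by simp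
  qed
  also have "\<dots> = real (gauss_binom TYPE('f) a b) * q_falling q b b"
    unfolding q_def by (rule gauss_binom_eq[symmetric])
  finally have "q ^ ((a - b) * b) \<le> real (gauss_binom TYPE('f) a b)" using F by simp
  moreover have "q ^ ((a - b) * b) = q powr (real b * (real a - real b))"
    using q b by (simp add: powr_realpow[symmetric] of_nat_diff mult.commute)
  ultimately show ?thesis by simp
qed

text \<open>The product over \<open>n\<close> divided by the one over \<open>j\<close> is a Gaussian
  binomial and costs a factor 4; the product over \<open>m\<close> is at most
  \<open>q^(m j)\<close>.\<close>

lemma A_bar_le:
  fixes q :: real
  defines "q \<equiv> real CARD('f::{field,finite})"
  assumes j: "j \<le> n" and nm: "n \<le> m"
  shows "A_bar CARD('f) m n k j \<le>
    4 * q powr (real m * (real k - real n) + real j * (real m + real n - real j))"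
proof -
  have q: "q > 1" unfolding q_def by (rule real_card_field_gt_1)
  have F: "q_falling q j j > 0" using q by (intro q_falling_pos) auto
  have "q_falling q n j = real (gauss_binom TYPE('f) n j) * q_falling q j j"
    unfolding q_def by (rule gauss_binom_eq[symmetric])
  hence "q_falling q n j / q_falling q j j = real (gauss_binom TYPE('f) n j)"
    using F by simp
  hence "A_bar CARD('f) m n k j = q powi (int m * (int k - int n)) *
      (q_falling q m j * real (gauss_binom TYPE('f) n j))"
    by (simp add: A_bar_def q_falling_def prod_dividef prod.distrib q_def flip: times_divide_eq_right)
  also have "\<dots> \<le> q powi (int m * (int k - int n)) *
      (q ^ (m * j) * (4 * q powr (real j * (real n - real j))))"
    using q q_falling_le[of q j m] j nm gauss_binom_le[where ?'f = 'f, of n j]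
    by (intro mult_left_mono mult_mono) (auto simp: q_def)
  also have "q powi (int m * (int k - int n)) = q powr (real m * (real k - real n))"
    using q powr_real_of_int'[of q "int m * (int k - int n)"] by simp
  also have "q ^ (m * j) = q powr (real m * real j)"
    using q by (simp add: powr_realpow[symmetric])
  also have "q powr (real m * (real k - real n)) *
      (q powr (real m * real j) * (4 * q powr (real j * (real n - real j)))) =
      4 * q powr (real m * (real k - real n) + real j * (real m + real n - real j))"
    by (simp add: powr_add[symmetric] algebra_simps)
  finally show ?thesis .
qed

section \<open>Size and decay of the summands\<close>

lemma sum_quarter_powers_rev_le: "(\<Sum>j=0..w. (1 / 4 :: real) ^ (w - j)) \<le> 4 / 3"
proof (induction w)
  case (Suc w)
  have "(\<Sum>j=0..w. (1 / 4 :: real) ^ (Suc w - j)) = (\<Sum>j=0..w. 1 / 4 * (1 / 4) ^ (w - j))"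
    by (intro sum.cong) (simp_all add: Suc_diff_le)
  also have "\<dots> = 1 / 4 * (\<Sum>j=0..w. (1 / 4) ^ (w - j))" by (simp only: sum_distrib_left)
  finally show ?case using Suc by simp
qed simp

lemma sum_quarter_powers_le: "(\<Sum>i=a..b. (1 / 4 :: real) ^ (i - a)) \<le> 4 / 3"
proof (cases "a \<le> b")
  case True
  have "(\<Sum>i=a..b. (1 / 4 :: real) ^ (i - a)) = (\<Sum>j=0..b - a. (1 / 4) ^ (b - a - j))"
    by (rule sum.reindex_bij_witness[of _ "\<lambda>j. b - j" "\<lambda>i. b - i"]) (use True in auto)
  thus ?thesis using sum_quarter_powers_rev_le[of "b - a"] by simp
qed simp

text \<open>
  The exponent of \<open>q\<close> in the estimate of the \<open>i\<close>-th summand of \<open>A_bar \<dots> j * P_RD \<dots> j\<close>; the power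
  \<open>q^((j-i)(\<delta>-i))\<close> of \<open>P_RD\<close> cancels against the cross terms of the Gaussian binomials.
\<close>

definition term_exponent :: "real \<Rightarrow> real \<Rightarrow> real \<Rightarrow> real \<Rightarrow> real \<Rightarrow> real \<Rightarrow> real" where
  "term_exponent m n k \<delta> j i = m * (k - n) + j * (m + n - j) - i * (n - \<delta> - j + i)"

text \<open>64 is a factor 4 from \<open>A_bar\<close> times 16 from the two Gaussian binomials in
  the numerator. The lower limit is \<open>j\<close> minus the number of errors correctable besides
  \<open>\<delta>\<close> erasures. In the case \<open>P_RD = 1\<close> it is 0, and the summand
  \<open>i = 0\<close> suffices.\<close>

lemma A_bar_mult_P_RD_le:
  fixes q :: real
  defines "q \<equiv> real CARD('f::{field,finite})"
  assumes j: "j \<le> n" and nm: "n \<le> m" and k: "k \<le> n" and \<delta>: "\<delta> \<le> n - k"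
  shows "A_bar CARD('f) m n k j * P_RD TYPE('f) n k \<delta> j \<le>
    (\<Sum>i \<in> {j - (n - k - \<delta>) div 2..j :: nat}. 64 * q powr term_exponent m n k \<delta> j i)"
proof -
  let ?s = "(n - k - \<delta>) div 2"
  let ?a = "real m * (real k - real n) + real j * (real m + real n - real j)"
  have q: "q > 1" unfolding q_def by (rule real_card_field_gt_1)
  have A: "A_bar CARD('f) m n k j \<le> 4 * q powr ?a"
    unfolding q_def by (rule A_bar_le[OF j nm])
  show ?thesis
  proof (cases "2 * j + \<delta> > n - k")
    case False
    hence js: "j - ?s = 0" by simp
    have "A_bar CARD('f) m n k j * P_RD TYPE('f) n k \<delta> j \<le> 4 * q powr ?a"
      using A False by (simp add: P_RD_def)
    also have "\<dots> \<le> 64 * q powr term_exponent m n k \<delta> j (real 0)"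
      by (simp add: term_exponent_def)
    also have "\<dots> \<le> (\<Sum>i = j - ?s..j. 64 * q powr term_exponent m n k \<delta> j (real i))"
      unfolding js by (rule member_le_sum) auto
    finally show ?thesis .
  next
    case True
    let ?lo = "nat \<lceil>real j - (real n - real k) / 2 + real \<delta> / 2\<rceil>"
    have lo: "j - ?s \<le> ?lo"
    proof -
      have "2 * ?s \<le> n - k - \<delta>" by simp
      hence "real (2 * ?s) + real k + real \<delta> \<le> real n"
        using k \<delta> by linarith
      moreover have "n - k - \<delta> < 2 * ?s + 2" by simp
      hence "real n < real (2 * ?s) + real k + real \<delta> + 2"
        using k \<delta> by linarith
      \<comment> \<open>\<open>z \<le> \<lceil>x\<rceil>\<close> means \<open>z - 1 < x\<close>,
        hence the 1; rounding in \<open>div 2\<close> loses less than one.\<close>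
      ultimately have "real_of_int (int j - int ?s - 1) < real j - (real n - real k) / 2 + real \<delta> / 2"
        by (simp add: field_simps)
      hence "int j - int ?s \<le> \<lceil>real j - (real n - real k) / 2 + real \<delta> / 2\<rceil>"
        by (simp add: le_ceiling_iff)
      thus ?thesis by linarith
    qed
    define t where "t i = real (gauss_binom TYPE('f) (n - j) (\<delta> - i)) * real (gauss_binom TYPE('f) j i) *
        q ^ ((j - i) * (\<delta> - i))" for i
    have t: "t i \<le> 16 * q powr ((real \<delta> - real i) * (real n - real \<delta>) + real i * (real j - real i))" if "i \<le> \<delta>" "i \<le> j" for i
    proof -
      have "t i \<le> (4 * q powr (real (\<delta> - i) * (real (n - j) - real (\<delta> - i)))) *
          (4 * q powr (real i * (real j - real i))) * q ^ ((j - i) * (\<delta> - i))"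
        unfolding t_def q_def by (intro mult_right_mono mult_mono gauss_binom_le) auto
      also have "q ^ ((j - i) * (\<delta> - i)) = q powr ((real j - real i) * (real \<delta> - real i))"
        using q that by (simp add: powr_realpow[symmetric] of_nat_diff)
      also have "real (\<delta> - i) * (real (n - j) - real (\<delta> - i)) =
          (real \<delta> - real i) * (real n - real j - (real \<delta> - real i))"
        using that j by (simp add: of_nat_diff)
      finally have "t i \<le> 16 * q powr ((real \<delta> - real i) * (real n - real j - (real \<delta> - real i)) +
          real i * (real j - real i) + (real j - real i) * (real \<delta> - real i))"
        by (simp add: powr_add)
      also have "(real \<delta> - real i) * (real n - real j - (real \<delta> - real i)) +
          real i * (real j - real i) + (real j - real i) * (real \<delta> - real i) =
          (real \<delta> - real i) * (real n - real \<delta>) + real i * (real j - real i)"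
        by (simp add: algebra_simps)
      finally show ?thesis .
    qed
    have "inverse (real (gauss_binom TYPE('f) n \<delta>)) \<le> inverse (q powr (real \<delta> * (real n - real \<delta>)))"
      using \<delta> q unfolding q_def by (intro le_imp_inverse_le gauss_binom_ge) auto
    hence g: "inverse (real (gauss_binom TYPE('f) n \<delta>)) \<le> q powr (- (real \<delta> * (real n - real \<delta>)))"
      by (simp add: powr_minus)
    have "A_bar CARD('f) m n k j * P_RD TYPE('f) n k \<delta> j =
        A_bar CARD('f) m n k j * (inverse (real (gauss_binom TYPE('f) n \<delta>)) * (\<Sum>i = ?lo..min \<delta> j. t i))"
      using True by (simp add: P_RD_def t_def q_def)
    also have "\<dots> \<le> (4 * q powr ?a) * (q powr (- (real \<delta> * (real n - real \<delta>))) *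
        (\<Sum>i = ?lo..min \<delta> j. 16 * q powr ((real \<delta> - real i) * (real n - real \<delta>) + real i * (real j - real i))))"
      using A g t q by (intro mult_mono sum_mono) (auto simp: t_def intro!: sum_nonneg mult_nonneg_nonneg)
    also have "\<dots> = (\<Sum>i = ?lo..min \<delta> j. 64 * q powr term_exponent m n k \<delta> j (real i))"
      unfolding sum_distrib_left
    proof (intro sum.cong refl)
      fix i
      have "?a + - (real \<delta> * (real n - real \<delta>)) + ((real \<delta> - real i) * (real n - real \<delta>) + real i * (real j - real i)) =
          term_exponent m n k \<delta> j (real i)"
        by (simp add: term_exponent_def algebra_simps)
      hence "q powr ?a * q powr (- (real \<delta> * (real n - real \<delta>))) *
          q powr ((real \<delta> - real i) * (real n - real \<delta>) + real i * (real j - real i)) =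
          q powr term_exponent m n k \<delta> j (real i)"
        by (simp only: powr_add[symmetric])
      thus "(4 * q powr ?a) * (q powr (- (real \<delta> * (real n - real \<delta>))) *
          (16 * q powr ((real \<delta> - real i) * (real n - real \<delta>) + real i * (real j - real i)))) =
          64 * q powr term_exponent m n k \<delta> j (real i)"
        by (simp add: mult_ac)
    qed
    also have "\<dots> \<le> (\<Sum>i = j - ?s..j. 64 * q powr term_exponent m n k \<delta> j (real i))"
      using lo by (intro sum_mono2) auto
    finally show ?thesis .
  qed
qed

text \<open>Raising \<open>i\<close> by \<open>t\<close> lowers the exponent by \<open>t\<close>
  times the bracket in \<open>eq\<close>. For \<open>t > 0\<close> both \<open>k\<close> and
  \<open>t\<close> contribute at least 1 to that bracket, whether or not \<open>j - s\<close>
  truncates.\<close>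

lemma term_exponent_add_le:
  fixes m n k \<delta> j t :: nat
  assumes k: "1 \<le> k" and kn: "k \<le> n" and \<delta>: "\<delta> \<le> n - k"
  defines "s \<equiv> (n - k - \<delta>) div 2"
  shows "term_exponent m n k \<delta> j (real (j - s + t)) \<le> term_exponent m n k \<delta> j (real (j - s)) - 2 * real t"
proof (cases t)
  case (Suc u)
  have eq: "term_exponent m n k \<delta> j (real (j - s + t)) = term_exponent m n k \<delta> j (real (j - s)) -
      real t * (real n - real \<delta> - real j + 2 * real (j - s) + real t)"
    by (simp add: term_exponent_def algebra_simps)
  have s: "2 * s + k + \<delta> \<le> n" unfolding s_def using kn \<delta> by linarith
  have "real n - real \<delta> - real j + 2 * real (j - s) + real t \<ge> 2"
  proof (cases "j \<le> s")
    case True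
    hence "\<delta> + j + 2 \<le> n + t" using s k Suc by linarith
    thus ?thesis using True by (simp add: of_nat_diff)
  next
    case False
    hence "\<delta> + 2 * s + 2 \<le> n + j + t" using s k Suc by linarith
    thus ?thesis using False by (simp add: of_nat_diff)
  qed
  hence "real t * 2 \<le> real t * (real n - real \<delta> - real j + 2 * real (j - s) + real t)"
    by (intro mult_left_mono) auto
  thus ?thesis unfolding eq by linarith
qed simp

text \<open>It is enough to compare \<open>j + 1\<close> with \<open>j\<close>. For
  \<open>j < s\<close> the least \<open>i\<close> stays 0, otherwise it moves along with
  \<open>j\<close>; in both cases \<open>2 w \<le> n - k + \<delta>\<close>, that is
  \<open>2 \<xi> \<le> \<delta>\<close>, makes the drop at least 2.\<close>

lemma term_exponent_diff_le:
  fixes m n k \<delta> w d :: nat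
  assumes k: "1 \<le> k" and kn: "k \<le> n" and nm: "n \<le> m" and \<delta>: "\<delta> \<le> n - k"
    and w: "2 * w \<le> n - k + \<delta>" and d: "d \<le> w"
  defines "s \<equiv> (n - k - \<delta>) div 2"
  shows "term_exponent m n k \<delta> (real (w - d)) (real (w - d - s)) \<le>
    term_exponent m n k \<delta> w (real (w - s)) - 2 * real d"
  using d
proof (induction d)
  case (Suc d)
  define j where "j = w - Suc d"
  have j: "w - d = Suc j" using Suc.prems by (simp add: j_def)
  have jw: "j + 1 \<le> w" using Suc.prems by (simp add: j_def)
  have s: "2 * s + k + \<delta> \<le> n" unfolding s_def using kn \<delta> by linarith
  have "term_exponent m n k \<delta> (real j) (real (j - s)) \<le>
      term_exponent m n k \<delta> (real (Suc j)) (real (Suc j - s)) - 2"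
  proof (cases "j < s")
    case True
    have "2 * j + 3 \<le> m + n" using jw w \<delta> nm kn k by linarith
    hence "real (2 * j + 3) \<le> real (m + n)" by (rule of_nat_mono)
    thus ?thesis using True by (simp add: term_exponent_def algebra_simps)
  next
    case False
    have "2 * j + 3 \<le> m + \<delta> + s" using jw w \<delta> nm kn k by linarith
    hence le: "real (2 * j + 3) \<le> real (m + \<delta> + s)" by (rule of_nat_mono)
    have "real (j - s) = real j - real s" "real (Suc j - s) = 1 + real j - real s"
      using False by (simp_all add: of_nat_diff)
    moreover have "term_exponent m n k \<delta> (real (Suc j)) (1 + real j - real s) =
        term_exponent m n k \<delta> (real j) (real j - real s) + (real m - 2 * real j - 1 + real \<delta> + real s)"
      by (simp add: term_exponent_def algebra_simps)
    ultimately show ?thesis using le by simp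
  qed
  thus ?case using Suc j by (simp add: j_def[symmetric])
qed simp

text \<open>With \<open>u = \<delta> / 2\<close>, the product subtracted in
  \<open>term_exponent\<close> is at least \<open>(\<xi> + u) (c - u)\<close>, since rounding down
  in \<open>s\<close> only enlarges both factors. The endpoints \<open>u = \<xi>\<close> and
  \<open>u = v\<close> give \<open>2 \<xi> (c - \<xi>)\<close> and \<open>w k\<close>.\<close>

lemma term_exponent_le:
  fixes m n k \<delta> w :: nat
  assumes kn: "k \<le> n" and \<delta>: "\<delta> \<le> n - k"
    and \<xi>: "\<xi> = real w - (real n - real k) / 2" and pos: "\<xi> > 0" and w: "2 * \<xi> \<le> real \<delta>"
  defines "s \<equiv> (n - k - \<delta>) div 2"
  shows "term_exponent m n k \<delta> w (real (w - s)) \<le>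
    - (real m * (real n - real k) - real w * (real n + real m) + (real w)\<^sup>2
       + min (2 * \<xi> * ((real n + real k) / 2 - \<xi>)) (real w * real k))"
proof -
  define u v c where "u = real \<delta> / 2" and "v = (real n - real k) / 2" and "c = (real n + real k) / 2"
  have uv: "\<xi> \<le> u" "u \<le> v" using w \<delta> kn by (auto simp: u_def v_def field_simps)
  have s: "2 * real s + real k + real \<delta> \<le> real n"
  proof -
    have "2 * s + k + \<delta> \<le> n" unfolding s_def using kn \<delta> by linarith
    hence "real (2 * s + k + \<delta>) \<le> real n" by (rule of_nat_mono)
    thus ?thesis by simp
  qed
  have "real s \<le> real w" using s pos \<xi> by (simp add: field_simps)
  hence ws: "real (w - s) = real w - real s" by (simp add: of_nat_diff)
  have i: "\<xi> + u \<le> real w - real s" using s \<xi> by (simp add: u_def field_simps)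
  have cu: "c - u \<ge> 0" using uv by (simp add: c_def v_def)
  have "(\<xi> + u) * (c - u) \<le> (real w - real s) * (real n - real \<delta> - real w + (real w - real s))"
  proof (rule mult_mono)
    show "c - u \<le> real n - real \<delta> - real w + (real w - real s)"
      using i \<xi> by (simp add: c_def u_def field_simps)
  qed (use i cu pos uv in auto)
  moreover have "min (2 * \<xi> * (c - \<xi>)) (real w * real k) \<le> (\<xi> + u) * (c - u)"
  proof -
    have wk: "real w * real k = (\<xi> + v) * (c - v)" by (simp add: \<xi> v_def c_def field_simps)
    \<comment> \<open>Concavity made explicit: the differences to both endpoint values factor. If
      \<open>c - 2 \<xi> - u\<close> is negative, then
      \<open>u + v - c + \<xi> > v - \<xi> \<ge> 0\<close>, so one difference is always
      nonnegative.\<close>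
    have 1: "(\<xi> + u) * (c - u) - 2 * \<xi> * (c - \<xi>) = (u - \<xi>) * (c - 2 * \<xi> - u)"
      by (simp add: algebra_simps)
    have 2: "(\<xi> + u) * (c - u) - (\<xi> + v) * (c - v) = (v - u) * (u + v - c + \<xi>)"
      by (simp add: algebra_simps)
    show ?thesis
    proof (cases "c - 2 * \<xi> - u \<ge> 0")
      case True
      hence "0 \<le> (u - \<xi>) * (c - 2 * \<xi> - u)" using uv by simp
      thus ?thesis using 1 by linarith
    next
      case False
      hence "0 \<le> (v - u) * (u + v - c + \<xi>)" using uv by (intro mult_nonneg_nonneg) auto
      thus ?thesis using 2 wk by linarith
    qed
  qed
  ultimately have "min (2 * \<xi> * (c - \<xi>)) (real w * real k) \<le>
      (real w - real s) * (real n - real \<delta> - real w + (real w - real s))" by linarith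
  thus ?thesis unfolding term_exponent_def ws c_def[symmetric]
    by (simp add: algebra_simps power2_eq_square)
qed

lemma sum_A_bar_P_RD_le:
  fixes q :: real
  defines "q \<equiv> real CARD('f::{field,finite})"
  assumes k: "1 \<le> k" and kn: "k \<le> n" and nm: "n \<le> m" and \<delta>: "\<delta> \<le> n - k"
    and \<xi>: "\<xi> = real w - (real n - real k) / 2" and pos: "\<xi> > 0" and w: "2 * \<xi> \<le> real \<delta>"
  shows "(\<Sum>j=0..w. A_bar CARD('f) m n k j * P_RD TYPE('f) n k \<delta> j) \<le>
    64 * real n * q powr (- (real m * (real n - real k) - real w * (real n + real m) + (real w)\<^sup>2
       + min (2 * \<xi> * ((real n + real k) / 2 - \<xi>)) (real w * real k)))"
    (is "_ \<le> 64 * real n * q powr (- ?E)")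
proof -
  define s where "s = (n - k - \<delta>) div 2"
  have q: "q \<ge> 2" unfolding q_def by (rule two_le_real_card_field)
  have "real (2 * w) \<le> real (n - k + \<delta>)" using w \<xi> kn by (simp add: of_nat_diff field_simps)
  hence w2: "2 * w \<le> n - k + \<delta>" by (simp only: of_nat_le_iff)
  hence wn: "w \<le> n - k" using \<delta> by linarith
  have "real w > 0" using \<xi> pos kn by (simp add: field_simps)
  hence n2: "2 \<le> n" using wn k by simp
  have quarter: "q powr (- (2 * real t)) \<le> (1 / 4) ^ t" for t
  proof -
    have "q powr (- (2 * real t)) \<le> 2 powr (- (2 * real t))"
      using q by (intro powr_mono2') auto
    also have "\<dots> = (1 / 4) ^ t"
      by (simp add: powr_minus powr_powr[symmetric] powr_realpow power_one_over inverse_eq_divide)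
    finally show ?thesis .
  qed
  have bound: "A_bar CARD('f) m n k j * P_RD TYPE('f) n k \<delta> j \<le>
      64 * (4 / 3) * q powr (- ?E) * (1 / 4) ^ (w - j)" if j: "j \<le> w" for j
  proof -
    let ?e = "term_exponent m n k \<delta> (real j)"
    have jn: "j \<le> n" using j wn by simp
    have "A_bar CARD('f) m n k j * P_RD TYPE('f) n k \<delta> j \<le>
        (\<Sum>i \<in> {j - s..j}. 64 * q powr ?e (real i))"
      unfolding s_def q_def by (rule A_bar_mult_P_RD_le[OF jn nm kn \<delta>])
    also have "\<dots> \<le> (\<Sum>i \<in> {j - s..j}. 64 * (q powr ?e (real (j - s)) * (1 / 4) ^ (i - (j - s))))"
    proof (intro sum_mono mult_left_mono)
      fix i assume i: "i \<in> {j - s..j}"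
      have "?e (real i) \<le> ?e (real (j - s)) + - (2 * real (i - (j - s)))"
        using term_exponent_add_le[OF k kn \<delta>, of m j "i - (j - s)"] i by (simp add: s_def)
      hence "q powr ?e (real i) \<le> q powr ?e (real (j - s)) * q powr (- (2 * real (i - (j - s))))"
        unfolding powr_add[symmetric] using q by (intro powr_mono) auto
      also have "\<dots> \<le> q powr ?e (real (j - s)) * (1 / 4) ^ (i - (j - s))"
        by (intro mult_left_mono quarter) auto
      finally show "q powr ?e (real i) \<le> q powr ?e (real (j - s)) * (1 / 4) ^ (i - (j - s))" .
    qed simp
    also have "\<dots> = 64 * q powr ?e (real (j - s)) * (\<Sum>i \<in> {j - s..j}. (1 / 4) ^ (i - (j - s)))"
      by (simp add: sum_distrib_left mult.assoc)
    also have "\<dots> \<le> 64 * q powr ?e (real (j - s)) * (4 / 3)"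
      by (intro mult_left_mono sum_quarter_powers_le) auto
    also have "\<dots> \<le> 64 * (q powr (- ?E) * (1 / 4) ^ (w - j)) * (4 / 3)"
    proof -
      have "?e (real (j - s)) \<le> term_exponent m n k \<delta> w (real (w - s)) - 2 * real (w - j)"
        using term_exponent_diff_le[OF k kn nm \<delta> w2, of "w - j"] j by (simp add: s_def)
      also have "\<dots> \<le> - ?E + - (2 * real (w - j))"
        using term_exponent_le[OF kn \<delta> \<xi> pos w, of m] by (simp add: s_def)
      finally have "q powr ?e (real (j - s)) \<le> q powr (- ?E) * q powr (- (2 * real (w - j)))"
        unfolding powr_add[symmetric] using q by (intro powr_mono) auto
      also have "\<dots> \<le> q powr (- ?E) * (1 / 4) ^ (w - j)"
        by (intro mult_left_mono quarter) auto
      finally show ?thesis by simp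
    qed
    finally show ?thesis by (simp add: mult_ac)
  qed
  have "(\<Sum>j=0..w. A_bar CARD('f) m n k j * P_RD TYPE('f) n k \<delta> j) \<le>
      (\<Sum>j=0..w. 64 * (4 / 3) * q powr (- ?E) * (1 / 4) ^ (w - j))"
    using bound by (intro sum_mono) auto
  also have "\<dots> = 64 * (4 / 3) * q powr (- ?E) * (\<Sum>j=0..w. (1 / 4) ^ (w - j))"
    by (simp only: sum_distrib_left)
  also have "\<dots> \<le> 64 * (4 / 3) * q powr (- ?E) * (4 / 3)"
    by (intro mult_left_mono sum_quarter_powers_rev_le) auto
  \<comment> \<open>\<open>(4/3)^2 < 2 \<le> n\<close> trades the constants for the factor
    \<open>n\<close>; here \<open>n \<ge> 2\<close> because
    \<open>1 \<le> w \<le> n - k < n\<close>.\<close>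
  also have "\<dots> \<le> 64 * real n * q powr (- ?E)"
  proof -
    have "2 * q powr (- ?E) \<le> real n * q powr (- ?E)" using n2 by (intro mult_right_mono) auto
    moreover have "0 \<le> q powr (- ?E)" by simp
    ultimately show ?thesis by linarith
  qed
  finally show ?thesis .
qed

text \<open>The summand \<open>j = 0\<close> is positive, because
  \<open>\<delta> \<le> n - k\<close> makes \<open>P_RD\<close> equal to 1 there. This justifies the
  divisions by the sum.\<close>

lemma sum_A_bar_P_RD_pos:
  fixes h :: "'f::{field,finite} \<Rightarrow> 'e::{field,finite}"
  assumes h: "field_embedding h" and \<delta>: "\<delta> \<le> CARD('n::finite) - k"
  shows "0 < (\<Sum>j=0..w. A_bar CARD('f) (ext_degree h) CARD('n) k j * P_RD TYPE('f) CARD('n) k \<delta> j)"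
proof (rule sum_pos2[of _ 0])
  show "0 < A_bar CARD('f) (ext_degree h) CARD('n) k 0 * P_RD TYPE('f) CARD('n) k \<delta> 0"
    using \<delta> by (simp add: A_bar_def P_RD_def)
next
  fix j
  have "P_RD TYPE('f) CARD('n) k \<delta> j \<ge> 0"
    by (auto simp: P_RD_def intro!: mult_nonneg_nonneg sum_nonneg)
  thus "0 \<le> A_bar CARD('f) (ext_degree h) CARD('n) k j * P_RD TYPE('f) CARD('n) k \<delta> j"
    unfolding A_bar_eq[OF h] by simp
qed auto

section \<open>Average cost and closed form of the work factor\<close>

theorem corollary1:
  fixes h :: "'f::{field,finite} \<Rightarrow> 'e::{field,finite}"
    and g :: "'e ^ 'n"
    and \<B> :: "('f ^ 'n) set \<Rightarrow> nat \<Rightarrow> 'f ^ 'n"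
    and q m n k w :: nat
    and \<xi> :: real
  assumes "q = CARD('f)" and "n = CARD('n)"
    and "field_embedding h" and "ext_degree h = m"
    and "1 \<le> k" and "k \<le> n" and "n \<le> m"
    and "real w > (real n - real k) / 2"
    and "\<xi> = real w - (real n - real k) / 2"
    and "entries_independent h g"
    and "\<And>U. vec.subspace U \<Longrightarrow>
           full_row_rank (vec.dim U) (\<B> U) \<and> row_space (vec.dim U) (\<B> U) = U"
  shows "(\<forall>\<delta>. 2 * \<xi> \<le> real \<delta> \<and> \<delta> \<le> n - k \<longrightarrow>
            rd_average_operations h k g \<delta> w \<B> \<ge> W_RD TYPE('f) m n k w) \<and>
         W_RD TYPE('f) m n k w \<ge>
           ennreal (real n / 64 * real q powr
             (real m * (real n - real k) - real w * (real n + real m) + (real w)\<^sup>2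
              + min (2 * \<xi> * ((real n + real k) / 2 - \<xi>)) (real w * real k)))"
proof -
  define s where "s \<delta> = (\<Sum>j=0..w. A_bar CARD('f) m n k j * P_RD TYPE('f) n k \<delta> j)" for \<delta>
  let ?E = "real m * (real n - real k) - real w * (real n + real m) + (real w)\<^sup>2
              + min (2 * \<xi> * ((real n + real k) / 2 - \<xi>)) (real w * real k)"
  have range: "\<delta> \<in> erasure_range n k w \<longleftrightarrow> 2 * \<xi> \<le> real \<delta> \<and> \<delta> \<le> n - k" for \<delta>
    by (simp add: erasure_range_def xi_def assms(9))
  have pos: "s \<delta> > 0" if "\<delta> \<le> n - k" for \<delta>
    using sum_A_bar_P_RD_pos[OF assms(3), where ?'n = 'n] that assms(2,4) by (simp add: s_def)
  have W: "W_RD TYPE('f) m n k w = (INF \<delta> \<in> erasure_range n k w. ennreal ((real n)\<^sup>2 / s \<delta>))"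
    by (simp add: W_RD_def s_def)
  have "rd_average_operations h k g \<delta> w \<B> \<ge> W_RD TYPE('f) m n k w"
    if \<delta>: "2 * \<xi> \<le> real \<delta>" "\<delta> \<le> n - k" for \<delta>
  proof -
    let ?G = "\<lambda>r. {U. rd_iteration h k g \<delta> w (\<B> U) r \<noteq> None}"
    let ?p = "pmf_of_set {U :: ('f ^ 'n) set. vec.subspace U \<and> vec.dim U = \<delta>}"
    have "(\<Sum>r\<in>UNIV. measure_pmf.prob ?p (?G r)) \<le> s \<delta> * real CARD('e ^ 'n)"
      using sum_success_probability_le[OF assms(3), of k \<delta> \<B> g w] assms(2,4,6,11) \<delta>
      by (simp add: s_def)
    \<comment> \<open>\<open>s \<delta>\<close> bounds the success probability averaged over
      \<open>r\<close>, so the mean number of iterations is at least its inverse.\<close>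
    hence "ennreal (1 / s \<delta>) \<le> (\<integral>\<^sup>+ (r, \<omega>). first_hit (?G r) \<omega>
        \<partial>(measure_pmf (pmf_of_set UNIV) \<Otimes>\<^sub>M stream_space (measure_pmf ?p)))"
      by (intro nn_integral_first_hit_pair_ge pos \<delta>)
    also have "\<dots> = (\<integral>\<^sup>+ (r, \<omega>). rd_num_iterations h k g \<delta> w \<B> r \<omega>
        \<partial>(measure_pmf (pmf_of_set UNIV) \<Otimes>\<^sub>M guesses \<delta>))"
      by (simp add: first_hit_def rd_num_iterations_def guesses_def)
    finally have "of_nat (n\<^sup>2) * ennreal (1 / s \<delta>) \<le> rd_average_operations h k g \<delta> w \<B>"
      unfolding rd_average_operations_def assms(2) by (intro mult_left_mono) auto
    moreover have "of_nat (n\<^sup>2) * ennreal (1 / s \<delta>) = ennreal ((real n)\<^sup>2 / s \<delta>)"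
      using pos[OF \<delta>(2)] by (simp add: ennreal_of_nat_eq_real_of_nat ennreal_mult[symmetric])
    moreover have "W_RD TYPE('f) m n k w \<le> ennreal ((real n)\<^sup>2 / s \<delta>)"
      unfolding W using \<delta> range by (intro INF_lower) auto
    ultimately show ?thesis by simp
  qed
  \<comment> \<open>Each \<open>\<delta>\<close> in the range is treated separately; if the range is
    empty, \<open>W_RD\<close> is \<open>\<infinity>\<close> and nothing is left to show.\<close>
  moreover have "ennreal (real n / 64 * real q powr ?E) \<le> W_RD TYPE('f) m n k w"
    unfolding W
  proof (intro INF_greatest ennreal_leI)
    fix \<delta> assume "\<delta> \<in> erasure_range n k w"
    hence \<delta>: "2 * \<xi> \<le> real \<delta>" "\<delta> \<le> n - k" by (simp_all add: range)
    \<comment> \<open>One factor of \<open>n^2\<close> is spent on the \<open>n\<close> in this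
      bound, which leaves \<open>n / 64\<close>.\<close>
    have "s \<delta> \<le> 64 * real n * real q powr (- ?E)"
      unfolding s_def assms(1)
      by (rule sum_A_bar_P_RD_le[OF assms(5-7) \<delta>(2) assms(9) _ \<delta>(1)]) (use assms(8,9) in simp)
    hence "(real n / 64 * real q powr ?E) * s \<delta> \<le>
        (real n / 64 * real q powr ?E) * (64 * real n * real q powr (- ?E))"
      by (intro mult_left_mono) auto
    also have "\<dots> = (real n)\<^sup>2 * (real q powr ?E * real q powr (- ?E))"
      by (simp add: power2_eq_square mult_ac)
    also have "real q powr ?E * real q powr (- ?E) = 1"
      using assms(1) by (simp add: powr_add[symmetric])
    finally show "real n / 64 * real q powr ?E \<le> (real n)\<^sup>2 / s \<delta>"
      using pos[OF \<delta>(2)] by (simp add: le_divide_eq)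
  qed
  ultimately show ?thesis by blast
qed

end
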